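(* Let $F$ be a finitely generated free group and let $H$ be a subgroup of $F$. Then $$Cl_{\mathbf{Su}}(H)=\bigcap_{p\in\mathbb{P}}Cl_{\mathbf{H}_p}(H),$$ where $\mathbb{P}$ is the set of all prime numbers.
   Context: A variety is a class of finite groups closed under taking subgroups, homomorphic images and (finite) direct products. The product $\mathbf{U}*\mathbf{V}$ of two varieties consists of all finite groups $G$ having a normal subgroup $N\in\mathbf{U}$ with $G/N\in\mathbf{V}$. A group $G$ is supersolvable if it has a series $1=H_0\le H_1\le\cdots\le H_n=G$ with each $H_i$ normal in $G$ and each $H_{i+1}/H_i$ cyclic; $\mathbf{Su}$ denotes the variety of all finite supersolvable groups. For a prime $p$, $\mathbf{G}_p$ is the variety of all finite $p$-groups; for a positive integer $d$, $\mathbf{Ab}_d$ is the variety of all finite abelian groups of exponent dividing $d$; and $\mathbf{H}_p=\mathbf{G}_p*\mathbf{Ab}_{p-1}$. For a variety $\mathbf{V}$, the pro-$\mathbf{V}$ topology on a group $F$ is the topology having as a basis of open sets all cosets $Kx$, where $x\in F$ and $K$ ranges over the normal subgroups of $F$ with $F/K\in\mathbf{V}$. The closure of a subset $S\subseteq F$ in this topology is denoted $Cl_{\mathbf{V}}(S)$. *)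

theory Defs
  imports
    "HOL-Algebra.Elementary_Groups"
    "HOL-Analysis.Abstract_Topology"
    "HOL-Computational_Algebra.Primes"
begin

text \<open>A word over \<open>X\<close> is a list of letters \<open>(b, x)\<close> with \<open>x \<in> X\<close>; the letter stands for \<open>x\<close> if
  \<open>b\<close> is true and for the inverse of \<open>x\<close> otherwise.\<close>

definition letter_value :: "('a, 'b) monoid_scheme \<Rightarrow> bool \<times> 'a \<Rightarrow> 'a" where
  "letter_value G l = (if fst l then snd l else inv\<^bsub>G\<^esub> (snd l))"

definition word_value :: "('a, 'b) monoid_scheme \<Rightarrow> (bool \<times> 'a) list \<Rightarrow> 'a" where
  "word_value G w = foldr (\<lambda>l g. letter_value G l \<otimes>\<^bsub>G\<^esub> g) w \<one>\<^bsub>G\<^esub>"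

definition reduced_words :: "'a set \<Rightarrow> (bool \<times> 'a) list set" where
  "reduced_words X =
     {w. snd ` set w \<subseteq> X \<and> successively (\<lambda>l m. \<not> (snd l = snd m \<and> fst l \<noteq> fst m)) w}"

text \<open>\<open>X\<close> is a basis of \<open>G\<close> if every element of \<open>G\<close> is the value of exactly one reduced word over
  \<open>X\<close>. (The universal property quantifies over groups of arbitrary type, so it cannot be used
  as a definition in HOL.)\<close>

definition free_basis :: "('a, 'b) monoid_scheme \<Rightarrow> 'a set \<Rightarrow> bool" where
  "free_basis G X \<longleftrightarrow>
     X \<subseteq> carrier G \<and> bij_betw (word_value G) (reduced_words X) (carrier G)"

definition free_group :: "('a, 'b) monoid_scheme \<Rightarrow> bool" where
  "free_group G \<longleftrightarrow> group G \<and> (\<exists>X. free_basis G X)"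

definition finitely_generated_group :: "('a, 'b) monoid_scheme \<Rightarrow> bool" where
  "finitely_generated_group G \<longleftrightarrow>
     group G \<and> (\<exists>S. finite S \<and> S \<subseteq> carrier G \<and> generate G S = carrier G)"

text \<open>A class of groups is represented by a predicate at each carrier type. In the product
  \<open>U * V\<close> the class \<open>U\<close> is taken at the type of \<open>G\<close>, and \<open>V\<close> at the type of its quotients.\<close>

definition variety_product ::
    "('a monoid \<Rightarrow> bool) \<Rightarrow> ('a set monoid \<Rightarrow> bool) \<Rightarrow> 'a monoid \<Rightarrow> bool" where
  "variety_product U V G \<longleftrightarrow>
     group G \<and> finite (carrier G) \<and> (\<exists>N. N \<lhd> G \<and> U (G\<lparr>carrier := N\<rparr>) \<and> V (G Mod N))"

definition supersolvable :: "'a monoid \<Rightarrow> bool" where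
  "supersolvable G \<longleftrightarrow>
     group G \<and>
     (\<exists>(n::nat) (H :: nat \<Rightarrow> 'a set).
        H 0 = {\<one>\<^bsub>G\<^esub>} \<and> H n = carrier G \<and>
        (\<forall>i\<le>n. H i \<lhd> G) \<and>
        (\<forall>i<n. H i \<subseteq> H (Suc i) \<and> cyclic_group ((G\<lparr>carrier := H (Suc i)\<rparr>) Mod H i)))"

definition variety_Su :: "'a monoid \<Rightarrow> bool" where
  "variety_Su G \<longleftrightarrow> finite (carrier G) \<and> supersolvable G"

definition variety_G :: "nat \<Rightarrow> 'a monoid \<Rightarrow> bool" where
  "variety_G p G \<longleftrightarrow> group G \<and> finite (carrier G) \<and> (\<exists>k. order G = p ^ k)"

definition variety_Ab :: "nat \<Rightarrow> 'a monoid \<Rightarrow> bool" where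
  "variety_Ab d G \<longleftrightarrow>
     comm_group G \<and> finite (carrier G) \<and> (\<forall>x\<in>carrier G. x [^]\<^bsub>G\<^esub> d = \<one>\<^bsub>G\<^esub>)"

definition variety_H :: "nat \<Rightarrow> 'a monoid \<Rightarrow> bool" where
  "variety_H p = variety_product (variety_G p) (variety_Ab (p - 1))"

definition pro_basis :: "('a set monoid \<Rightarrow> bool) \<Rightarrow> 'a monoid \<Rightarrow> 'a set set" where
  "pro_basis V F = {K #>\<^bsub>F\<^esub> x | K x. K \<lhd> F \<and> V (F Mod K) \<and> x \<in> carrier F}"

text \<open>If \<open>V\<close> is a variety, then two cosets \<open>K x\<close> and \<open>L y\<close> in \<open>pro_basis V F\<close> are disjoint or meet
  in a coset of \<open>K \<inter> L\<close>, where \<open>F Mod (K \<inter> L)\<close> embeds into \<open>F Mod K \<times> F Mod L\<close>. So the generated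
  topology has \<open>pro_basis V F\<close> as a basis, not just as a subbasis.\<close>

definition pro_topology :: "('a set monoid \<Rightarrow> bool) \<Rightarrow> 'a monoid \<Rightarrow> 'a topology" where
  "pro_topology V F = topology_generated_by (pro_basis V F)"

definition Cl :: "('a set monoid \<Rightarrow> bool) \<Rightarrow> 'a monoid \<Rightarrow> 'a set \<Rightarrow> 'a set" where
  "Cl V F S = pro_topology V F closure_of S"

end

theory Submission
  imports Defs "HOL-Algebra.Sylow" "HOL-Algebra.Group_Action" "HOL-Number_Theory.Residues"
    "HOL-Computational_Algebra.Polynomial"
begin

text \<open>
  A finite group that has a normal \<open>p\<close>-subgroup with abelian quotient of exponent
  dividing \<open>p - 1\<close> is supersolvable (\<open>prime_series_of_p_by_abelian\<close>):
  each nontrivial quotient contains a nontrivial cyclic normal subgroup, because commuting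
  operators of order dividing \<open>p - 1\<close> on a vector space over the field with
  \<open>p\<close> elements have a common eigenvector. So the pro-supersolvable topology is finer
  than each pro-\<open>\<^bold>H\<^sub>p\<close> topology, which gives one inclusion.

  For the other inclusion, let \<open>x\<close> lie outside the pro-supersolvable closure of
  \<open>H\<close>. Some normal \<open>K\<close> with \<open>F / K\<close> finite supersolvable
  satisfies \<open>x \<notin> K H\<close>, since such \<open>K\<close> are closed under
  intersection; choose one of minimal index. Let \<open>G = F / K\<close>, and let
  \<open>S\<close> be the image of \<open>H\<close>. By minimality, the image of \<open>x\<close>
  lies outside \<open>S\<close> but in \<open>N S\<close> for every nontrivial normal subgroup
  \<open>N\<close> of \<open>G\<close>. It follows that \<open>G\<close> itself belongs to
  \<open>\<^bold>H\<^sub>p\<close> for some \<open>p\<close> (\<open>exists_variety_H\<close>), so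
  \<open>x\<close> is not in the pro-\<open>\<^bold>H\<^sub>p\<close> closure of \<open>H\<close>.

  To see that \<open>G\<close> belongs to \<open>\<^bold>H\<^sub>p\<close>, suppose that
  \<open>G\<close> had normal subgroups of two different prime orders. They would centralize each
  other, and from \<open>x \<in> N S\<close> for both of them it would follow that \<open>x \<in>
  S\<close>. So there is one prime \<open>p\<close> such that every normal subgroup of prime order
  has order \<open>p\<close>. Let \<open>D\<close> consist of the elements that centralize all
  factors of order \<open>p\<close> in a series of normal subgroups with factors of prime order.
  Then \<open>G / D\<close> is abelian of exponent dividing \<open>p - 1\<close>, and
  \<open>D\<close> is a \<open>p\<close>-group (\<open>exists_detecting_subgroup\<close>): the
  \<open>p\<close>-regular elements of \<open>D\<close> centralize the \<open>p\<close>-group that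
  \<open>D\<close> has in common with the lower terms of the series, so if \<open>D\<close> met a
  next factor of order \<open>q \<noteq> p\<close> nontrivially, then \<open>G\<close> would have
  a normal subgroup of order \<open>q\<close>.
\<close>

section \<open>Cosets and powers\<close>

lemma (in normal) mem_rcos_iff:
  assumes "x \<in> carrier G" "y \<in> carrier G"
  shows "x \<in> H #> y \<longleftrightarrow> H #> x = H #> y"
  by (metis assms repr_independence rcos_self subgroup_axioms)

lemma (in normal) rcos_eq_iff:
  assumes "x \<in> carrier G" "y \<in> carrier G"
  shows "H #> x = H #> y \<longleftrightarrow> x \<otimes> inv y \<in> H"
  using mem_rcos_iff[OF assms] rcos_module[OF is_group assms(2,1)] by simp

lemma (in normal) rcos_eq_one_iff:
  assumes "x \<in> carrier G"
  shows "H #> x = H \<longleftrightarrow> x \<in> H"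
  by (metis assms coset_join2 rcos_self subgroup_axioms)

lemma (in normal) r_coset_group_hom: "group_hom G (G Mod H) (\<lambda>x. H #> x)"
  by (simp add: group_hom_def group_hom_axioms_def is_group factorgroup_is_group r_coset_hom_Mod)

lemma (in group) pow_mod_of_pow_one:
  assumes "x \<in> carrier G" "x [^] n = \<one>" "[k = l] (mod (n::nat))"
  shows "x [^] k = x [^] l"
proof -
  have *: "x [^] j = x [^] (j mod n)" for j
  proof -
    have "x [^] j = x [^] (n * (j div n) + j mod n)" by simp
    also have "\<dots> = (x [^] n) [^] (j div n) \<otimes> x [^] (j mod n)"
      using assms(1) by (simp only: nat_pow_mult[symmetric] nat_pow_pow)
    finally show ?thesis using assms by simp
  qed
  show ?thesis using * assms(3) by (metis cong_def)
qed

lemma (in group) exists_power_generating: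
  assumes c: "c \<in> carrier G" "c [^] q = \<one>" and q: "prime (q::nat)" and ne: "c [^] (l::nat) \<noteq> \<one>"
  shows "\<exists>j. c = (c [^] l) [^] (j::nat)"
proof -
  have "\<not> q dvd l"
  proof
    assume "q dvd l"
    then have "c [^] l = c [^] (0::nat)" by (intro pow_mod_of_pow_one[OF c]) (simp add: cong_0_iff)
    then show False using ne by simp
  qed
  then have "coprime l q" using q by (metis coprime_commute prime_imp_coprime)
  then obtain j where "[l * j = 1] (mod q)" using cong_solve_coprime_nat by auto
  then have "c [^] (l * j) = c [^] (1::nat)" by (rule pow_mod_of_pow_one[OF c])
  then have "(c [^] l) [^] j = c" using c(1) by (simp add: nat_pow_pow)
  then show ?thesis by metis
qed

lemma (in group) conj_nat_pow:
  assumes "g \<in> carrier G" "b \<in> carrier G"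
  shows "(g \<otimes> b \<otimes> inv g) [^] (k::nat) = g \<otimes> b [^] k \<otimes> inv g"
proof (induction k)
  case (Suc k)
  have "inv g \<otimes> (g \<otimes> t) = t" if "t \<in> carrier G" for t
    using assms that by (simp flip: m_assoc)
  then show ?case using Suc assms by (simp add: m_assoc)
qed (use assms in auto)

section \<open>Series of normal subgroups with factors of prime order\<close>

text \<open>The elements \<open>z\<close> whose coset modulo \<open>M\<close> is a power of the coset of \<open>b\<close>. Only exponents in
  \<open>\<nat>\<close> are used: some positive power of \<open>b\<close> lies in \<open>M\<close> wherever this is applied, so this set is
  the subgroup generated by \<open>M\<close> and \<open>b\<close> as soon as \<open>M\<close> is normal.\<close>

definition cyclic_over :: "('a, 'b) monoid_scheme \<Rightarrow> 'a set \<Rightarrow> 'a \<Rightarrow> 'a set" where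
  "cyclic_over G M b = {z \<in> carrier G. \<exists>k::nat. z \<in> M #>\<^bsub>G\<^esub> b [^]\<^bsub>G\<^esub> k}"

lemma (in normal) in_cyclic_over_iff:
  assumes "b \<in> carrier G"
  shows "z \<in> cyclic_over G H b \<longleftrightarrow>
    z \<in> carrier G \<and> (\<exists>k::nat. H #> z = (H #> b) [^]\<^bsub>G Mod H\<^esub> k)"
  unfolding cyclic_over_def using assms by (auto simp: FactGroup_pow mem_rcos_iff)

lemma (in normal) cyclic_over_normal:
  assumes b: "b \<in> carrier G" and n: "b [^] n \<in> H" "n > (0::nat)"
    and conj: "\<And>g. g \<in> carrier G \<Longrightarrow> g \<otimes> b \<otimes> inv g \<in> cyclic_over G H b"
  shows "cyclic_over G H b \<lhd> G"
proof -
  let ?Q = "G Mod H"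
  interpret Q: group ?Q by (rule factorgroup_is_group)
  interpret h: group_hom G ?Q "\<lambda>x. H #> x" by (rule r_coset_group_hom)
  define c where "c = H #> b"
  have c: "c \<in> carrier ?Q" using b c_def by simp
  have cn: "c [^]\<^bsub>?Q\<^esub> n = \<one>\<^bsub>?Q\<^esub>"
    using b n by (simp add: c_def FactGroup_pow rcos_eq_one_iff)
  have mem: "z \<in> cyclic_over G H b \<longleftrightarrow> z \<in> carrier G \<and> (\<exists>k::nat. H #> z = c [^]\<^bsub>?Q\<^esub> k)" for z
    using in_cyclic_over_iff[OF b] c_def by simp
  have "subgroup (cyclic_over G H b) G"
  proof (rule subgroupI)
    show "cyclic_over G H b \<subseteq> carrier G" by (auto simp: cyclic_over_def)
    have "\<one> \<in> cyclic_over G H b"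
      unfolding mem by (auto intro!: exI[of _ "0::nat"] simp: rcos_eq_one_iff)
    then show "cyclic_over G H b \<noteq> {}" by auto
    fix x assume x: "x \<in> cyclic_over G H b"
    then obtain k :: nat where k: "x \<in> carrier G" "H #> x = c [^]\<^bsub>?Q\<^esub> k" using mem by auto
    have "c [^]\<^bsub>?Q\<^esub> k \<otimes>\<^bsub>?Q\<^esub> c [^]\<^bsub>?Q\<^esub> (n * k - k) = c [^]\<^bsub>?Q\<^esub> (n * k)"
      using n(2) c by (simp add: Q.nat_pow_mult del: mult_FactGroup)
    also have "\<dots> = \<one>\<^bsub>?Q\<^esub>" using c cn by (metis Q.nat_pow_one Q.nat_pow_pow)
    finally have "inv\<^bsub>?Q\<^esub> (c [^]\<^bsub>?Q\<^esub> k) = c [^]\<^bsub>?Q\<^esub> (n * k - k)"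
      using c by (metis Q.inv_equality Q.inv_inv Q.nat_pow_closed Q.inv_closed)
    then show "inv x \<in> cyclic_over G H b"
      using k by (auto simp: mem h.hom_inv simp del: one_FactGroup mult_FactGroup)
    fix y assume "y \<in> cyclic_over G H b"
    then obtain l :: nat where l: "y \<in> carrier G" "H #> y = c [^]\<^bsub>?Q\<^esub> l" using mem by auto
    have "H #> (x \<otimes> y) = c [^]\<^bsub>?Q\<^esub> (k + l)"
      using k l c by (simp add: h.hom_mult Q.nat_pow_mult del: mult_FactGroup)
    then show "x \<otimes> y \<in> cyclic_over G H b" using k l mem by auto
  qed
  moreover have "g \<otimes> x \<otimes> inv g \<in> cyclic_over G H b"
    if g: "g \<in> carrier G" and x: "x \<in> cyclic_over G H b" for g x
  proof -
    obtain k :: nat where k: "x \<in> carrier G" "H #> x = c [^]\<^bsub>?Q\<^esub> k" using x mem by auto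
    obtain j :: nat where j: "H #> (g \<otimes> b \<otimes> inv g) = c [^]\<^bsub>?Q\<^esub> j" using conj[OF g] mem by auto
    have "H #> (g \<otimes> x \<otimes> inv g) = H #> (g \<otimes> b [^] k \<otimes> inv g)"
      using g k b by (simp add: h.hom_mult FactGroup_pow[symmetric] c_def del: mult_FactGroup)
    also have "\<dots> = (c [^]\<^bsub>?Q\<^esub> j) [^]\<^bsub>?Q\<^esub> k"
      unfolding conj_nat_pow[OF g b, symmetric] using g b j by (simp flip: FactGroup_pow)
    also have "\<dots> = c [^]\<^bsub>?Q\<^esub> (j * k)" using c by (simp add: Q.nat_pow_pow)
    finally show ?thesis using g k mem by auto
  qed
  ultimately show ?thesis by (simp add: normal_inv_iff)
qed

text \<open>\<open>N / M\<close> is cyclic of order \<open>1\<close> or a prime: it is generated by the coset of some \<open>a\<close> with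
  \<open>a\<^sup>q \<in> M\<close>. The trivial quotient is deliberately allowed, since it arises when a series is
  mapped to a quotient or intersected with a normal subgroup.\<close>

definition prime_step :: "('a, 'b) monoid_scheme \<Rightarrow> 'a set \<Rightarrow> 'a set \<Rightarrow> bool" where
  "prime_step G M N \<longleftrightarrow> M \<subseteq> N \<and>
     (\<exists>(q::nat) a. prime q \<and> a \<in> N \<and> a [^]\<^bsub>G\<^esub> q \<in> M \<and> N \<subseteq> cyclic_over G M a)"

text \<open>\<open>M\<close> is the bottom of a series of normal subgroups of \<open>G\<close> that reaches \<open>G\<close> through prime
  steps. For normal \<open>K\<close> of finite index in \<open>F\<close>, this says that \<open>F / K\<close> is supersolvable, but
  it is a property of a subgroup of \<open>F\<close> and so needs no quotient type.\<close>

inductive prime_series :: "('a, 'b) monoid_scheme \<Rightarrow> 'a set \<Rightarrow> bool" for G where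
  top: "prime_series G (carrier G)"
| step: "prime_series G N \<Longrightarrow> M \<lhd> G \<Longrightarrow> prime_step G M N \<Longrightarrow> prime_series G M"

lemma (in group) prime_series_normal: "prime_series G M \<Longrightarrow> M \<lhd> G"
  by (induction rule: prime_series.induct)
     (auto simp: normal_inv_iff subgroup_self)

text \<open>A cyclic step of a series refines to prime steps: if the coset of \<open>b\<close> generates \<open>N / M\<close> and
  \<open>b\<^sup>n \<in> M\<close> with \<open>q\<close> a prime divisor of \<open>n\<close>, then \<open>b\<^sup>q\<close> and \<open>M\<close> generate a subgroup that is
  again normal in \<open>G\<close>.\<close>

lemma (in group) prime_series_cyclic_step:
  assumes "prime_series G (cyclic_over G M b)" "M \<lhd> G" "b \<in> carrier G"
    "b [^] n \<in> M" "n > (0::nat)"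
    and conj: "\<And>g. g \<in> carrier G \<Longrightarrow> g \<otimes> b \<otimes> inv g \<in> cyclic_over G M b"
  shows "prime_series G M"
  using assms(1,3-)
proof (induction n arbitrary: b rule: less_induct)
  case (less n)
  interpret normal M G by fact
  let ?Q = "G Mod M"
  interpret Q: group ?Q by (rule factorgroup_is_group)
  interpret h: group_hom G ?Q "\<lambda>x. M #> x" by (rule r_coset_group_hom)
  note b = less.prems(2)
  show ?case
  proof (cases "n = 1")
    case True
    then have "b \<in> M" using less.prems by simp
    then have "M #> b [^] k = M" for k :: nat
      using b by (metis FactGroup_pow Q.nat_pow_one one_FactGroup rcos_const is_group)
    then have "cyclic_over G M b = M" using subset by (auto simp: cyclic_over_def)
    then show ?thesis using less.prems(1) by simp
  next
    case False
    then obtain q where q: "prime q" "q dvd n" using prime_factor_nat by blast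
    then obtain m where m: "n = q * m" by auto
    have "m > 0" using m less.prems(4) by (cases m) auto
    moreover have "m < n" using m \<open>m > 0\<close> prime_gt_1_nat[OF q(1)] by simp
    ultimately have mn: "m > 0" "m < n" by auto
    define b' where "b' = b [^] q"
    have b': "b' \<in> carrier G" using b b'_def by simp
    have b'm: "b' [^] m \<in> M" using less.prems(3) m b by (simp add: b'_def nat_pow_pow)
    have conj': "g \<otimes> b' \<otimes> inv g \<in> cyclic_over G M b'" if g: "g \<in> carrier G" for g
    proof -
      obtain j :: nat where j: "M #> (g \<otimes> b \<otimes> inv g) = (M #> b) [^]\<^bsub>?Q\<^esub> j"
        using less.prems(5)[OF g] in_cyclic_over_iff[OF b] by auto
      have "M #> (g \<otimes> b' \<otimes> inv g) = ((M #> b) [^]\<^bsub>?Q\<^esub> j) [^]\<^bsub>?Q\<^esub> q"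
        unfolding b'_def conj_nat_pow[OF g b, symmetric] using g b j by (simp flip: FactGroup_pow)
      also have "\<dots> = (M #> b') [^]\<^bsub>?Q\<^esub> j"
        using b by (simp add: b'_def Q.nat_pow_pow mult.commute flip: FactGroup_pow)
      finally show ?thesis using g b' in_cyclic_over_iff[OF b'] by auto
    qed
    have norm: "cyclic_over G M b' \<lhd> G"
      by (rule cyclic_over_normal[OF b' b'm mn(1) conj'])
    have sub: "cyclic_over G M b' \<subseteq> cyclic_over G M b"
      unfolding cyclic_over_def b'_def using b by (auto simp: nat_pow_pow)
    have selfmem: "x \<in> cyclic_over G M x" if "x \<in> carrier G" for x
      unfolding cyclic_over_def using that rcos_self[OF that subgroup_axioms]
      by (auto intro!: exI[of _ "1::nat"])
    have Msub: "M \<subseteq> cyclic_over G M b'"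
      unfolding cyclic_over_def using subset by (auto intro!: exI[of _ "0::nat"])
    have "cyclic_over G M b \<subseteq> cyclic_over G (cyclic_over G M b') b"
      unfolding cyclic_over_def[of G M b] cyclic_over_def[of G "cyclic_over G M b'" b]
      using Msub by (auto simp: r_coset_def)
    then have "prime_step G (cyclic_over G M b') (cyclic_over G M b)"
      unfolding prime_step_def using sub q(1) selfmem[OF b] selfmem[OF b'] b'_def by auto
    then have "prime_series G (cyclic_over G M b')"
      using prime_series.step less.prems(1) norm by blast
    then show ?thesis using less.IH[OF mn(2) _ b' b'm mn(1) conj'] by blast
  qed
qed

lemma (in group) prime_series_inter_step:
  assumes "prime_step G M N" "M \<lhd> G" "N \<lhd> G" "K \<lhd> G"
  shows "prime_step G (K \<inter> M) (K \<inter> N)"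
proof -
  interpret normal M G by fact
  interpret N: normal N G by fact
  interpret K: normal K G by fact
  let ?Q = "G Mod M"
  interpret Q: group ?Q by (rule factorgroup_is_group)
  interpret h: group_hom G ?Q "\<lambda>x. M #> x" by (rule r_coset_group_hom)
  obtain q a where q: "prime (q::nat)" and a: "a \<in> N" "a [^] q \<in> M" and N: "N \<subseteq> cyclic_over G M a"
    and MN: "M \<subseteq> N"
    using assms(1) unfolding prime_step_def by blast
  have aG: "a \<in> carrier G" using a by simp
  define c where "c = M #> a"
  have c: "c \<in> carrier ?Q" "c [^]\<^bsub>?Q\<^esub> q = \<one>\<^bsub>?Q\<^esub>"
    using aG a by (auto simp: c_def FactGroup_pow rcos_eq_one_iff)
  have ex: "\<exists>k::nat. M #> z = c [^]\<^bsub>?Q\<^esub> k" if "z \<in> N" for z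
    using N that in_cyclic_over_iff[OF aG] c_def by blast
  show ?thesis
  proof (cases "K \<inter> N \<subseteq> M")
    case True
    moreover have "(K \<inter> M) #> \<one> = K \<inter> M" using subset by (intro coset_mult_one) auto
    ultimately have "K \<inter> N \<subseteq> cyclic_over G (K \<inter> M) \<one>"
      using K.subset by (auto simp: cyclic_over_def)
    then show ?thesis using MN
      unfolding prime_step_def
      by (auto intro!: exI[of _ "2::nat"] exI[of _ "\<one>"])
  next
    case False
    then obtain y where y: "y \<in> K" "y \<in> N" "y \<notin> M" by auto
    have yG: "y \<in> carrier G" using y by auto
    obtain k :: nat where k: "M #> y = c [^]\<^bsub>?Q\<^esub> k" using ex y by blast
    have "c [^]\<^bsub>?Q\<^esub> k \<noteq> \<one>\<^bsub>?Q\<^esub>"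
      unfolding k[symmetric] using y(3) yG rcos_eq_one_iff by simp
    then obtain j :: nat where "c = (c [^]\<^bsub>?Q\<^esub> k) [^]\<^bsub>?Q\<^esub> j"
      using Q.exists_power_generating[OF c q] by blast
    then have j: "c = M #> y [^] j" using k yG by (simp flip: FactGroup_pow)
    have yq: "y [^] q \<in> M"
    proof -
      have "M #> y [^] q = (c [^]\<^bsub>?Q\<^esub> k) [^]\<^bsub>?Q\<^esub> q" using k yG by (simp flip: FactGroup_pow)
      also have "\<dots> = (c [^]\<^bsub>?Q\<^esub> q) [^]\<^bsub>?Q\<^esub> k" using c(1) by (simp only: Q.nat_pow_pow mult.commute)
      also have "\<dots> = M" using c(2) by (metis Q.nat_pow_one one_FactGroup)
      finally show ?thesis using yG rcos_eq_one_iff by simp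
    qed
    have pK: "x [^] l \<in> K" if "x \<in> K" for x and l :: nat
      using that by (induction l) auto
    have "K \<inter> N \<subseteq> cyclic_over G (K \<inter> M) y"
    proof
      fix z assume z: "z \<in> K \<inter> N"
      then have zG: "z \<in> carrier G" by auto
      obtain l :: nat where l: "M #> z = c [^]\<^bsub>?Q\<^esub> l" using ex z by blast
      have "M #> y [^] (j * l) = c [^]\<^bsub>?Q\<^esub> l"
        unfolding j using yG by (simp add: FactGroup_pow nat_pow_pow)
      also have "\<dots> = M #> z" using l by simp
      finally have "z \<otimes> inv (y [^] (j * l)) \<in> M"
        using zG yG rcos_eq_iff[of z "y [^] (j * l)"] by simp
      moreover have "z \<otimes> inv (y [^] (j * l)) \<in> K" using z pK[OF y(1)] by auto
      moreover have "z = (z \<otimes> inv (y [^] (j * l))) \<otimes> y [^] (j * l)"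
        using zG yG by (simp add: m_assoc)
      ultimately show "z \<in> cyclic_over G (K \<inter> M) y"
        unfolding cyclic_over_def r_coset_def using zG by blast
    qed
    moreover have "y \<in> K \<inter> N" "y [^] q \<in> K \<inter> M" "K \<inter> M \<subseteq> K \<inter> N"
      using MN y pK[OF y(1)] yq by auto
    ultimately show ?thesis unfolding prime_step_def using q by blast
  qed
qed

text \<open>If \<open>F / K\<close> and \<open>F / L\<close> have prime series, then so has \<open>F / (K \<inter> L)\<close>: below the series that
  ends in \<open>K\<close>, intersect \<open>K\<close> with each term of the series that ends in \<open>L\<close>.\<close>

lemma (in group) prime_series_inter:
  assumes "prime_series G K" "prime_series G L"
  shows "prime_series G (K \<inter> L)"
  using assms(2)
proof (induction rule: prime_series.induct)
  case top
  have "K \<inter> carrier G = K"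
    using prime_series_normal[OF assms(1)] normal_imp_subgroup subgroup.subset by blast
  then show ?case using assms(1) by simp
next
  case (step N M)
  have K: "K \<lhd> G" using prime_series_normal assms by blast
  have "prime_step G (K \<inter> M) (K \<inter> N)"
    using prime_series_inter_step step prime_series_normal K by blast
  moreover have "K \<inter> M \<lhd> G" using K step by (simp add: normal_subgroup_intersect)
  ultimately show ?case using step.IH prime_series.step by blast
qed

lemma (in group_hom) prime_series_image:
  assumes surj: "h ` carrier G = carrier H" and "prime_series G M"
  shows "prime_series H (h ` M)"
  using assms(2)
proof (induction rule: prime_series.induct)
  case top
  show ?case unfolding surj by (rule prime_series.top)
next
  case (step N M)
  interpret M: normal M G by fact
  have NG: "N \<subseteq> carrier G"
    using step G.prime_series_normal normal_imp_subgroup subgroup.subset by blast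
  obtain q a where q: "prime (q::nat)" and a: "a \<in> N" "a [^] q \<in> M" and N: "N \<subseteq> cyclic_over G M a"
    and MN: "M \<subseteq> N"
    using step unfolding prime_step_def by blast
  have aG: "a \<in> carrier G" using a NG by auto
  have "h ` N \<subseteq> cyclic_over H (h ` M) (h a)"
  proof
    fix w assume "w \<in> h ` N"
    then obtain z where z: "z \<in> N" "w = h z" by auto
    obtain k :: nat where "z \<in> M #> a [^] k" using N z by (auto simp: cyclic_over_def)
    then obtain m where m: "m \<in> M" "z = m \<otimes> a [^] k" by (auto simp: r_coset_def)
    have "w = h m \<otimes>\<^bsub>H\<^esub> (h a) [^]\<^bsub>H\<^esub> k" using m z aG by (simp add: hom_nat_pow)
    moreover have "w \<in> carrier H" using z NG by auto
    ultimately show "w \<in> cyclic_over H (h ` M) (h a)"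
      using m by (auto simp: cyclic_over_def r_coset_def)
  qed
  moreover have "h a [^]\<^bsub>H\<^esub> q \<in> h ` M" using a aG by (simp flip: hom_nat_pow)
  ultimately have "prime_step H (h ` M) (h ` N)"
    unfolding prime_step_def using q a MN by blast
  moreover have "h ` M \<lhd> H" using M.surj_hom_normal_subgroup[OF group_hom_axioms surj] .
  ultimately show ?case using step prime_series.step by blast
qed

lemma (in group_hom) normal_preimage:
  assumes "M \<lhd> H"
  shows "{x \<in> carrier G. h x \<in> M} \<lhd> G"
proof -
  interpret M: normal M H by fact
  show ?thesis unfolding G.normal_inv_iff
    by (auto intro!: G.subgroupI M.inv_op_closed2)
qed

lemma (in group_hom) prime_series_preimage:
  assumes surj: "h ` carrier G = carrier H" and "prime_series H M"
  shows "prime_series G {x \<in> carrier G. h x \<in> M}"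
  using assms(2)
proof (induction rule: prime_series.induct)
  case top
  have "{x \<in> carrier G. h x \<in> carrier H} = carrier G" by auto
  then show ?case using prime_series.top[of G] by simp
next
  case (step N M)
  interpret M: normal M H by fact
  have NH: "N \<subseteq> carrier H"
    using step H.prime_series_normal normal_imp_subgroup subgroup.subset by blast
  obtain q b where q: "prime (q::nat)" and b: "b \<in> N" "b [^]\<^bsub>H\<^esub> q \<in> M"
    and N: "N \<subseteq> cyclic_over H M b" and MN: "M \<subseteq> N"
    using step unfolding prime_step_def by blast
  obtain a where a: "a \<in> carrier G" "h a = b" using surj b NH by (metis image_iff subsetD)
  let ?p = "\<lambda>M. {x \<in> carrier G. h x \<in> M}"
  have "?p N \<subseteq> cyclic_over G (?p M) a"
  proof
    fix z assume z: "z \<in> ?p N"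
    then obtain k :: nat where "h z \<in> M #>\<^bsub>H\<^esub> b [^]\<^bsub>H\<^esub> k" using N by (auto simp: cyclic_over_def)
    then have "h z \<otimes>\<^bsub>H\<^esub> inv\<^bsub>H\<^esub> (b [^]\<^bsub>H\<^esub> k) \<in> M"
      using M.rcos_module[OF H.is_group] z a by auto
    then have "z \<otimes> inv (a [^] k) \<in> ?p M" using z a by (simp add: hom_nat_pow)
    moreover have "z = z \<otimes> inv (a [^] k) \<otimes> a [^] k" using z a by (simp add: G.m_assoc)
    ultimately show "z \<in> cyclic_over G (?p M) a"
      using z unfolding cyclic_over_def r_coset_def by blast
  qed
  moreover have "a \<in> ?p N" "a [^] q \<in> ?p M" using a b by (auto simp: hom_nat_pow)
  ultimately have "prime_step G (?p M) (?p N)"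
    unfolding prime_step_def using q MN by blast
  then show ?case using step prime_series.step normal_preimage by blast
qed

section \<open>Supersolvable groups\<close>

lemma (in group) int_pow_eq_nat_pow:
  assumes "finite (carrier G)" "b \<in> carrier G"
  shows "\<exists>j::nat. b [^] (k::int) = b [^] j"
proof (cases "k \<ge> 0")
  case True
  then show ?thesis by (metis int_pow_int nat_0_le)
next
  case False
  define m where "m = nat (- k)"
  have m: "b [^] k = inv (b [^] m)"
    using int_pow_neg_int[OF assms(2), of m] False by (simp add: m_def)
  have ord: "Coset.order G > 0" using assms order_gt_0_iff_finite by blast
  have "b [^] (Coset.order G * m - m) \<otimes> b [^] m = b [^] (Coset.order G * m)"
    using assms ord by (simp add: nat_pow_mult)
  also have "\<dots> = \<one>" using assms by (simp add: pow_order_eq_1 flip: nat_pow_pow)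
  finally have "inv (b [^] m) = b [^] (Coset.order G * m - m)"
    using assms by (intro inv_equality) auto
  then show ?thesis using m by auto
qed

lemma (in group) prime_series_of_cyclic_quotient:
  assumes fin: "finite (carrier G)" and N: "prime_series G N" and M: "M \<lhd> G" "M \<subseteq> N"
    and cyc: "cyclic_group ((G\<lparr>carrier := N\<rparr>) Mod M)"
  shows "prime_series G M"
proof -
  interpret M: normal M G by fact
  interpret N: normal N G using N prime_series_normal by blast
  let ?N = "G\<lparr>carrier := N\<rparr>"
  have "M \<lhd> ?N" using normal_restrict_supergroup M N.subgroup_axioms by blast
  then interpret MN: normal M ?N .
  interpret Q: group "?N Mod M" by (rule MN.factorgroup_is_group)
  obtain C where C: "C \<in> carrier (?N Mod M)" "carrier (?N Mod M) = range (\<lambda>n::int. C [^]\<^bsub>?N Mod M\<^esub> n)"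
    using cyc Q.cyclic_group by blast
  from C(1) obtain b where b: "b \<in> N" "C = M #> b" by (auto simp: carrier_FactGroup)
  have bG: "b \<in> carrier G" using b by auto
  have "N \<subseteq> cyclic_over G M b"
  proof
    fix z assume z: "z \<in> N"
    then have "M #> z \<in> carrier (?N Mod M)" by (auto simp: carrier_FactGroup)
    then obtain k :: int where "M #> z = C [^]\<^bsub>?N Mod M\<^esub> k" using C by blast
    also have "\<dots> = M #> b [^] k"
      using MN.FactGroup_int_pow[of b k] b int_pow_consistent[OF N.subgroup_axioms b(1)] by simp
    finally have "M #> z = M #> b [^] k" .
    moreover obtain j :: nat where "b [^] k = b [^] j" using int_pow_eq_nat_pow[OF fin bG] by blast
    ultimately show "z \<in> cyclic_over G M b"
      using z bG by (auto simp: cyclic_over_def M.mem_rcos_iff)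
  qed
  moreover have "cyclic_over G M b \<subseteq> N"
  proof
    fix z assume "z \<in> cyclic_over G M b"
    then obtain k :: nat and m where "m \<in> M" "z = m \<otimes> b [^] k"
      by (auto simp: cyclic_over_def r_coset_def)
    moreover have "b [^] k \<in> N" using b(1) by (induction k) auto
    ultimately show "z \<in> N" using M by auto
  qed
  ultimately have eq: "cyclic_over G M b = N" by blast
  have "b [^] Coset.order G \<in> M" using bG by (simp add: pow_order_eq_1)
  moreover have "Coset.order G > 0" using fin order_gt_0_iff_finite by blast
  ultimately show ?thesis
    using prime_series_cyclic_step[OF _ M(1) bG] N b(1) N.inv_op_closed2 unfolding eq by blast
qed

lemma (in group) cyclic_quotient_of_prime_step:
  assumes "prime_step G M N" "M \<lhd> G" "N \<lhd> G"
  shows "cyclic_group ((G\<lparr>carrier := N\<rparr>) Mod M)"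
proof -
  interpret M: normal M G by fact
  interpret N: normal N G by fact
  let ?N = "G\<lparr>carrier := N\<rparr>"
  obtain a where a: "a \<in> N" "N \<subseteq> cyclic_over G M a" and MN: "M \<subseteq> N"
    using assms unfolding prime_step_def by blast
  have aG: "a \<in> carrier G" using a by auto
  have "M \<lhd> ?N" using normal_restrict_supergroup MN assms N.subgroup_axioms by blast
  then interpret MN: normal M ?N .
  interpret Q: group "?N Mod M" by (rule MN.factorgroup_is_group)
  have c: "M #> a \<in> carrier (?N Mod M)" using a by (auto simp: carrier_FactGroup)
  have "carrier (?N Mod M) \<subseteq> range (\<lambda>n::int. (M #> a) [^]\<^bsub>?N Mod M\<^esub> n)"
  proof
    fix Z assume "Z \<in> carrier (?N Mod M)"
    then obtain z where z: "z \<in> N" "Z = M #> z" by (auto simp: carrier_FactGroup)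
    then obtain k :: nat where "z \<in> M #> a [^] k" using a by (auto simp: cyclic_over_def)
    then have "Z = M #> a [^] k" using z aG M.mem_rcos_iff by auto
    also have "\<dots> = (M #> a) [^]\<^bsub>?N Mod M\<^esub> k"
      using MN.FactGroup_pow[of a k] a nat_pow_consistent[of a k N] by simp
    finally show "Z \<in> range (\<lambda>n::int. (M #> a) [^]\<^bsub>?N Mod M\<^esub> n)"
      by (metis int_pow_int rangeI)
  qed
  moreover have "range (\<lambda>n::int. (M #> a) [^]\<^bsub>?N Mod M\<^esub> n) \<subseteq> carrier (?N Mod M)"
    using c by auto
  ultimately show ?thesis using Q.cyclic_group c by blast
qed

lemma supersolvable_iff_prime_series:
  assumes "group G" "finite (carrier G)"
  shows "supersolvable G \<longleftrightarrow> prime_series G {\<one>\<^bsub>G\<^esub>}"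
proof
  interpret group G by fact
  assume "supersolvable G"
  then obtain n :: nat and H where H: "H 0 = {\<one>\<^bsub>G\<^esub>}" "H n = carrier G" "\<And>i. i \<le> n \<Longrightarrow> H i \<lhd> G"
    "\<And>i. i < n \<Longrightarrow> H i \<subseteq> H (Suc i) \<and> cyclic_group ((G\<lparr>carrier := H (Suc i)\<rparr>) Mod H i)"
    unfolding supersolvable_def by metis
  have "i \<le> n \<Longrightarrow> prime_series G (H i)" for i
  proof (induction i rule: inc_induct[of _ n, simplified])
    show "prime_series G (H n)" unfolding H by (rule prime_series.top)
  next
    fix i assume "i < n" "prime_series G (H (Suc i))"
    then show "prime_series G (H i)"
      using prime_series_of_cyclic_quotient[OF assms(2)] H by simp
  qed
  then show "prime_series G {\<one>\<^bsub>G\<^esub>}" using H(1) by (metis le0)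
next
  interpret group G by fact
  assume "prime_series G {\<one>\<^bsub>G\<^esub>}"
  moreover have "\<exists>(n::nat) H. H 0 = M \<and> H n = carrier G \<and> (\<forall>i\<le>n. H i \<lhd> G) \<and>
      (\<forall>i<n. H i \<subseteq> H (Suc i) \<and> cyclic_group ((G\<lparr>carrier := H (Suc i)\<rparr>) Mod H i))"
    if "prime_series G M" for M
    using that
  proof (induction rule: prime_series.induct)
    case top
    show ?case using prime_series_normal[OF prime_series.top]
      by (intro exI[of _ "0::nat"] exI[of _ "\<lambda>_. carrier G"]) auto
  next
    case (step N M)
    then obtain n :: nat and H where H: "H 0 = N" "H n = carrier G" "\<forall>i\<le>n. H i \<lhd> G"
      "\<forall>i<n. H i \<subseteq> H (Suc i) \<and> cyclic_group ((G\<lparr>carrier := H (Suc i)\<rparr>) Mod H i)"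
      by blast
    have *: "cyclic_group ((G\<lparr>carrier := N\<rparr>) Mod M)" "M \<subseteq> N"
      using cyclic_quotient_of_prime_step[OF step(3,2) prime_series_normal[OF step(1)]] step(3)
      by (simp_all add: prime_step_def)
    have 1: "case_nat M H i \<lhd> G" if "i \<le> Suc n" for i
      using that H(3) step(2) by (cases i) auto
    have 2: "case_nat M H i \<subseteq> case_nat M H (Suc i) \<and>
        cyclic_group ((G\<lparr>carrier := case_nat M H (Suc i)\<rparr>) Mod case_nat M H i)" if "i < Suc n" for i
    proof (cases i)
      case 0
      then show ?thesis using H(1) * by simp
    next
      case (Suc j)
      then show ?thesis using H(4) that by simp
    qed
    show ?case
      using 1 2 H(2) by (intro exI[of _ "Suc n"] exI[of _ "case_nat M H"] conjI allI impI) simp_all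
  qed
  ultimately show "supersolvable G" unfolding supersolvable_def using assms by blast
qed

lemma variety_Su_FactGroup_iff:
  assumes "group F" "K \<lhd> F"
  shows "variety_Su (F Mod K) \<longleftrightarrow> finite (carrier (F Mod K)) \<and> prime_series F K"
proof -
  interpret normal K F by fact
  let ?Q = "F Mod K"
  interpret Q: group ?Q by (rule factorgroup_is_group)
  interpret h: group_hom F ?Q "\<lambda>x. K #>\<^bsub>F\<^esub> x" by (rule r_coset_group_hom)
  have surj: "(\<lambda>x. K #>\<^bsub>F\<^esub> x) ` carrier F = carrier ?Q" by (simp add: carrier_FactGroup)
  have "{x \<in> carrier F. K #>\<^bsub>F\<^esub> x \<in> {\<one>\<^bsub>?Q\<^esub>}} = K"
    using rcos_eq_one_iff subset by auto
  moreover have "(\<lambda>x. K #>\<^bsub>F\<^esub> x) ` K = {\<one>\<^bsub>?Q\<^esub>}"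
    unfolding one_FactGroup using rcos_const[OF is_group] subgroup.one_closed[OF subgroup_axioms]
    by blast
  ultimately have "prime_series ?Q {\<one>\<^bsub>?Q\<^esub>} \<longleftrightarrow> prime_series F K"
    using h.prime_series_image[OF surj] h.prime_series_preimage[OF surj] by metis
  then show ?thesis
    unfolding variety_Su_def using supersolvable_iff_prime_series[OF Q.is_group] by blast
qed

section \<open>Eigenvectors of automorphisms of order dividing p - 1\<close>

text \<open>An integer polynomial with more roots modulo \<open>p\<close> than its degree has all coefficients divisible
  by \<open>p\<close>, which is what divisibility by the constant polynomial expresses.\<close>

lemma prime_dvd_poly_of_roots:
  fixes f :: "int poly"
  assumes "prime p" "finite S" "\<And>x. x \<in> S \<Longrightarrow> p dvd poly f x"
    "\<And>x y. \<lbrakk>x \<in> S; y \<in> S; p dvd x - y\<rbrakk> \<Longrightarrow> x = y" "degree f < card S"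
  shows "[:p:] dvd f"
  using assms(2-)
proof (induction "degree f" arbitrary: f S)
  case 0
  then obtain c where c: "f = [:c:]" by (metis degree_eq_zeroE)
  obtain x where "x \<in> S" using 0 by fastforce
  then show ?case using 0(3) c by (auto simp: const_poly_dvd_iff coeff_pCons split: nat.split)
next
  case (Suc n)
  obtain a where a: "a \<in> S" using Suc.prems(4) by fastforce
  define g where "g = synthetic_div f a"
  have f: "f = [:-a, 1:] * g + [:poly f a:]" using synthetic_div_correct'[of a f] g_def by simp
  have "p dvd poly g x" if x: "x \<in> S - {a}" for x
  proof -
    have "poly f x = (x - a) * poly g x + poly f a" by (subst f) (simp add: algebra_simps)
    then have "p dvd (x - a) * poly g x"
      using Suc.prems(2)[of x] Suc.prems(2)[OF a] x by (metis DiffD1 dvd_add_left_iff)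
    moreover have "\<not> p dvd x - a" using Suc.prems(3)[of x a] a x by auto
    ultimately show ?thesis using assms(1) prime_dvd_multD by blast
  qed
  moreover have "degree g = n" using Suc(2) by (simp add: g_def degree_synthetic_div)
  moreover have "card (S - {a}) = card S - 1" using a Suc.prems(1) by simp
  ultimately have "[:p:] dvd g"
    using Suc(1)[of g "S - {a}"] Suc.prems Suc(2) by simp
  moreover have "[:p:] dvd [:poly f a:]"
    using Suc.prems(2)[OF a] by (auto simp: const_poly_dvd_iff coeff_pCons split: nat.split)
  ultimately show ?case by (subst f) (intro dvd_add dvd_mult)
qed

lemma prime_dvd_prod_linear_minus:
  assumes p: "prime (p::nat)"
  shows "[:int p:] dvd (\<Prod>k=1..p-1. [:-int k, 1:]) - (Polynomial.monom 1 (p - 1) - 1)"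
proof -
  let ?P = "\<Prod>k=1..p-1. [:-int k, 1:]" and ?M = "Polynomial.monom (1::int) (p - 1) - 1"
  have p1: "p > 1" using p prime_gt_1_nat by blast
  have degP: "degree ?P = p - 1" by (subst degree_prod_eq_sum_degree) auto
  have lcP: "lead_coeff ?P = 1" by (subst lead_coeff_prod) simp
  have degM: "degree ?M \<le> p - 1" by (intro degree_diff_le) (auto simp: degree_monom_le)
  have "coeff (?P - ?M) (p - 1) = 0" using degP lcP p1 by simp
  moreover have "degree (?P - ?M) \<le> p - 1" by (rule degree_diff_le[OF eq_refl[OF degP] degM])
  ultimately have "degree (?P - ?M) < p - 1"
    using p1 by (metis degree_0 leading_coeff_0_iff le_neq_implies_less zero_less_diff)
  then have deg: "degree (?P - ?M) < card (int ` {1..p-1})" by (simp add: card_image)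
  show ?thesis
  proof (rule prime_dvd_poly_of_roots[OF _ _ _ _ deg])
    show "prime (int p)" using p by simp
    fix x assume "x \<in> int ` {1..p-1}"
    then obtain k where k: "x = int k" "k \<in> {1..p-1}" by auto
    have "poly ?P x = 0" using k by (auto simp: poly_prod)
    moreover have "\<not> p dvd k" using k p1 by (auto dest: dvd_imp_le)
    then have "[k ^ (p - 1) = 1] (mod p)" using fermat_theorem p by blast
    then have "int p dvd int k ^ (p - 1) - 1"
      by (metis cong_iff_dvd_diff cong_int_iff of_nat_1 of_nat_power)
    ultimately show "int p dvd poly (?P - ?M) x"
      using k by (simp add: poly_monom) (metis dvd_minus_iff minus_diff_eq)
  next
    fix x y assume "x \<in> int ` {1..p-1}" "y \<in> int ` {1..p-1}" and d: "int p dvd x - y"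
    then have "\<bar>x - y\<bar> < int p" using p1 by auto
    then show "x = y" using d zdvd_imp_le[of "int p" "\<bar>x - y\<bar>"] by fastforce
  qed auto
qed

text \<open>The value at \<open>v\<close> of the endomorphism \<open>f(T)\<close> of an abelian group, where \<open>f\<close> is an integer
  polynomial. As the group is written multiplicatively, \<open>f(T)\<close> sends \<open>v\<close> to the product of the
  elements \<open>T\<^sup>i(v)\<close> raised to the \<open>i\<close>-th coefficient; it is evaluated by Horner's rule.\<close>

definition poly_act :: "('a, 'b) monoid_scheme \<Rightarrow> ('a \<Rightarrow> 'a) \<Rightarrow> int poly \<Rightarrow> 'a \<Rightarrow> 'a" where
  "poly_act G T f v = fold_coeffs (\<lambda>a r. v [^]\<^bsub>G\<^esub> a \<otimes>\<^bsub>G\<^esub> T r) f \<one>\<^bsub>G\<^esub>"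

context comm_group
begin

context
  fixes T v
  assumes T: "T \<in> hom G G" and v: "v \<in> carrier G"
begin

interpretation T: group_hom G G T
  using T by (simp add: group_hom_def group_hom_axioms_def)

lemma poly_act_pCons [simp]: "poly_act G T (pCons a f) v = v [^] a \<otimes> T (poly_act G T f v)"
  unfolding poly_act_def by (cases "a = 0 \<and> f = 0") auto

lemma poly_act_0 [simp]: "poly_act G T 0 v = \<one>"
  by (simp add: poly_act_def)

lemma poly_act_closed [simp]: "poly_act G T f v \<in> carrier G"
  by (induction f) (use v in auto)

lemma poly_act_add: "poly_act G T (f + g) v = poly_act G T f v \<otimes> poly_act G T g v"
  by (induction f g rule: poly_induct2) (use v in \<open>auto simp: int_pow_mult m_ac\<close>)

lemma poly_act_smult: "poly_act G T (smult c f) v = poly_act G T f v [^] c"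
  by (induction f)
    (use v in \<open>auto simp: int_pow_distrib int_pow_pow mult.commute T.hom_int_pow\<close>)

lemma poly_act_linear_mult:
  "poly_act G T ([:-c, 1:] * f) v = T (poly_act G T f v) \<otimes> inv (poly_act G T f v [^] c)"
  by (simp add: poly_act_add poly_act_smult int_pow_neg m_comm v flip: smult_minus_left)

lemma poly_act_monom: "poly_act G T (Polynomial.monom 1 n) v = (T ^^ n) v"
proof (induction n)
  case (Suc n)
  then have "(T ^^ n) v \<in> carrier G" by (metis poly_act_closed)
  with Suc show ?case using v by (simp add: monom_Suc)
qed (use v in \<open>simp add: monom_0\<close>)

end

text \<open>An endomorphism \<open>T\<close> of an abelian group of exponent \<open>p\<close> has an eigenvector if \<open>T\<^sup>p\<^sup>-\<^sup>1\<close>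
  fixes some \<open>v \<noteq> 1\<close>. Modulo \<open>p\<close> the product of the polynomials \<open>X - k\<close> for \<open>1 \<le> k < p\<close> is \<open>X\<^sup>p\<^sup>-\<^sup>1 - 1\<close>, so applying the
  factors to \<open>v\<close> one after the other ends in the identity. The last value different from the identity
  is an eigenvector.\<close>

lemma exists_eigenvector:
  assumes T: "T \<in> hom G G" and v: "v \<in> carrier G" "v \<noteq> \<one>" and p: "prime p"
    and exp: "\<And>x. x \<in> carrier G \<Longrightarrow> x [^] p = \<one>" and Tp: "(T ^^ (p - 1)) v = v"
  shows "\<exists>u k. u \<in> carrier G \<and> u \<noteq> \<one> \<and> T u = u [^] (k::nat)"
proof -
  have T1: "T \<one> = \<one>" using hom_one[OF T is_group is_group] .
  let ?P = "\<lambda>j. \<Prod>k=1..j. [:-int k, 1:]"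
  let ?e = "\<lambda>f. poly_act G T f v"
  obtain g where g: "?P (p - 1) - (Polynomial.monom 1 (p - 1) - 1) = smult (int p) g"
    using prime_dvd_prod_linear_minus[OF p] by (auto elim!: dvdE)
  have "?P (p - 1) = smult (int p) g + (Polynomial.monom 1 (p - 1) + [:-1:])"
    using g by (simp only: diff_eq_eq) (simp add: one_pCons)
  also have "?e \<dots> = ?e g [^] int p \<otimes> (v \<otimes> v [^] (-1::int))"
    using T v Tp T1 by (simp add: poly_act_add poly_act_smult poly_act_monom)
  also have "\<dots> = \<one>" using T v exp by (simp add: int_pow_int int_pow_neg)
  finally have "?e (?P (p - 1)) = \<one>" .
  then obtain j where j: "?e (?P j) = \<one>" "\<And>i. i < j \<Longrightarrow> ?e (?P i) \<noteq> \<one>"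
    using exists_least_iff[of "\<lambda>j. ?e (?P j) = \<one>"] by blast
  have "?e (?P 0) = v" using T v T1 by (simp add: one_pCons)
  then have "j \<noteq> 0" using j v by (metis)
  then obtain i where i: "j = Suc i" by (cases j) auto
  let ?u = "?e (?P i)"
  have u: "?u \<in> carrier G" using T v by simp
  have "?P j = [:-int j, 1:] * ?P i" unfolding i by (simp add: mult.commute)
  then have "T ?u \<otimes> inv (?u [^] j) = \<one>"
    using j(1) poly_act_linear_mult[OF T v(1), of "int j" "?P i"] by (simp add: int_pow_int)
  moreover have "T ?u \<in> carrier G" using T u by (auto simp: hom_def)
  ultimately have "T ?u = ?u [^] j" using u by (metis inv_closed inv_equality inv_inv nat_pow_closed)
  then show ?thesis using u j(2) i by blast
qed

end

section \<open>Groups of prime power order\<close>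

lemma (in group) one_if_coprime_powers:
  assumes "x \<in> carrier G" "x [^] m = \<one>" "x [^] n = \<one>" "coprime m (n::nat)"
  shows "x = \<one>"
proof -
  have "ord x dvd m" "ord x dvd n" using assms pow_eq_id by auto
  then have "ord x dvd 1" using assms(4) by (metis coprime_common_divisor is_unit_gcd)
  then show ?thesis using assms(1) pow_eq_id[of x 1] by simp
qed

text \<open>A finite group all of whose elements have \<open>p\<close>-power order is a \<open>p\<close>-group: for another prime
  divisor \<open>q\<close> of the order, Sylow's theorem gives a subgroup of order \<open>q\<close>.\<close>

lemma (in group) order_eq_prime_power:
  assumes fin: "finite (carrier G)" and p: "prime p"
    and el: "\<And>x. x \<in> carrier G \<Longrightarrow> \<exists>k. x [^] (p ^ k) = \<one>"
  shows "\<exists>k. Coset.order G = p ^ k"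
proof -
  have only: "q = p" if q: "prime q" "q dvd Coset.order G" for q
  proof (rule ccontr)
    assume "q \<noteq> p"
    obtain m where "Coset.order G = q ^ 1 * m" using q by auto
    then obtain S where S: "subgroup S G" "card S = q"
      using sylow_thm[OF q(1) is_group _ fin] by (metis power_one_right)
    interpret S: group "G\<lparr>carrier := S\<rparr>" using S(1) subgroup_imp_group by blast
    have "\<not> S \<subseteq> {\<one>}" using S(2) prime_gt_1_nat[OF q(1)]
      by (metis card.empty card_1_singleton_iff subset_singletonD less_one nat_neq_iff One_nat_def not_less0)
    then obtain x where x: "x \<in> S" "x \<noteq> \<one>" by auto
    have xG: "x \<in> carrier G" using x S subgroup.mem_carrier by metis
    have "x [^] q = \<one>" using S.pow_order_eq_1[of x] x S(2) nat_pow_consistent[of x q S]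
      by (simp add: Coset.order_def)
    moreover obtain k where "x [^] (p ^ k) = \<one>" using el xG by blast
    moreover have "coprime q (p ^ k)" using \<open>q \<noteq> p\<close> p q primes_coprime by auto
    ultimately show False using one_if_coprime_powers x xG by blast
  qed
  have "Coset.order G \<noteq> 0" using fin order_gt_0_iff_finite by simp
  then obtain m where m: "Coset.order G = p ^ multiplicity p (Coset.order G) * m" "\<not> p dvd m"
    using multiplicity_decompose' p by (metis not_prime_unit)
  have "m = 1"
  proof (rule ccontr)
    assume "m \<noteq> 1"
    then obtain q where "prime q" "q dvd m" using prime_factor_nat by blast
    then show False using only m by (metis dvd_mult)
  qed
  then show ?thesis using m(1) by auto
qed

text \<open>The centre of a nontrivial \<open>p\<close>-group is nontrivial: the conjugacy classes with more than one
  element have size divisible by \<open>p\<close>.\<close>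

lemma (in group) exists_central_element:
  assumes p: "prime p" and card: "Coset.order G = p ^ n" and nt: "carrier G \<noteq> {\<one>}"
  shows "\<exists>z \<in> carrier G. z \<noteq> \<one> \<and> (\<forall>g \<in> carrier G. g \<otimes> z = z \<otimes> g)"
proof (rule ccontr)
  assume none: "\<not> ?thesis"
  let ?\<phi> = "\<lambda>g. (\<lambda>h \<in> carrier G. g \<otimes> h \<otimes> (inv g))"
  interpret A: group_action G "carrier G" ?\<phi> by (rule action_by_conjugation)
  let ?O = "orbits G (carrier G) ?\<phi>"
  have ppos: "p ^ n > 0" using prime_gt_0_nat[OF p] by simp
  then have fin: "finite (carrier G)" using card order_gt_0_iff_finite by simp
  have "n \<noteq> 0"
  proof
    assume "n = 0"
    then have "carrier G = {\<one>}" using card order_one_triv_iff by simp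
    then show False using nt by simp
  qed
  then have pd: "p dvd Coset.order G" using card by simp
  have finO: "finite ?O" using fin by (simp add: orbits_def)
  have orb1: "orbit G ?\<phi> \<one> = {\<one>}"
  proof -
    have "?\<phi> g \<one> = \<one>" if "g \<in> carrier G" for g using that by simp
    then have "(\<lambda>g. ?\<phi> g \<one>) ` carrier G = (\<lambda>g. \<one>) ` carrier G" by (rule image_cong[OF refl])
    moreover have "orbit G ?\<phi> \<one> = (\<lambda>g. ?\<phi> g \<one>) ` carrier G" unfolding orbit_def by blast
    ultimately show ?thesis using image_constant[OF one_closed] by metis
  qed
  then have 1: "{\<one>} \<in> ?O" unfolding orbits_def using one_closed by blast
  have div: "p dvd card B" if B: "B \<in> ?O - {{\<one>}}" for B
  proof -
    obtain x where x: "x \<in> carrier G" "B = orbit G ?\<phi> x" using B by (auto simp: orbits_def)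
    have "card B * card (stabilizer G ?\<phi> x) = p ^ n"
      using A.orbit_stabilizer_theorem[OF x(1)] unfolding x(2) card .
    then have "card B dvd p ^ n" by (intro dvdI) (rule sym)
    then obtain i where i: "card B = p ^ i" using p by (auto simp: divides_primepow_nat)
    have "i \<noteq> 0"
    proof
      assume "i = 0"
      then obtain y where y: "B = {y}" using i card_1_singletonE by auto
      have xB: "x \<in> B" using A.orbit_refl[OF x(1)] x by simp
      have "g \<otimes> x = x \<otimes> g" if g: "g \<in> carrier G" for g
      proof -
        have "?\<phi> g x \<in> B" using g x by (auto simp: orbit_def)
        then have "g \<otimes> x \<otimes> inv g = x" using y xB x by simp
        then show ?thesis using g x by (metis inv_solve_right m_closed)
      qed
      then have "x = \<one>" using none x by blast
      then show False using B x orb1 by simp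
    qed
    then show ?thesis using i by simp
  qed
  have "Coset.order G = (\<Sum>B\<in>?O. card B)"
    using A.disjoint_sum[OF fin, of "\<lambda>_. 1::nat"] by (simp add: Coset.order_def)
  also have "\<dots> = 1 + (\<Sum>B\<in>?O - {{\<one>}}. card B)"
    using sum.remove[OF finO 1, of card] by simp
  finally have "p dvd 1 + (\<Sum>B\<in>?O - {{\<one>}}. card B)" using pd by simp
  moreover have "p dvd (\<Sum>B\<in>?O - {{\<one>}}. card B)" using div by (rule dvd_sum)
  ultimately have "p dvd 1" using dvd_add_left_iff by blast
  then show False using p by simp
qed

lemma (in group) conj_funpow:
  assumes "g \<in> carrier G" "v \<in> carrier G"
  shows "((\<lambda>x. g \<otimes> x \<otimes> inv g) ^^ n) v = g [^] n \<otimes> v \<otimes> inv (g [^] n)"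
proof (induction n)
  case (Suc n)
  have "g [^] Suc n = g \<otimes> g [^] n" using assms by (metis nat_pow_Suc2)
  then show ?case using Suc assms by (simp add: m_assoc inv_mult_group)
qed (use assms in simp)

text \<open>The central elements of order dividing \<open>p\<close> in a nontrivial normal \<open>p\<close>-subgroup of \<open>G\<close> form a
  nontrivial normal subgroup of \<open>G\<close>.\<close>

lemma (in group) central_exponent_subgroup:
  assumes P: "P \<lhd> G" and p: "prime p" and card: "card P = p ^ n" and nt: "P \<noteq> {\<one>}"
  defines "W \<equiv> {v \<in> P. v [^] p = \<one> \<and> (\<forall>x\<in>P. x \<otimes> v = v \<otimes> x)}"
  shows "W \<lhd> G" "W \<noteq> {\<one>}"
proof -
  interpret P: normal P G by fact
  have cW: "x \<otimes> v = v \<otimes> x" if "x \<in> P" "v \<in> W" for x v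
    using that unfolding W_def by blast
  have WD: "v \<in> P" "v [^] p = \<one>" if "v \<in> W" for v
    using that unfolding W_def by blast+
  have WI: "v \<in> W" if "v \<in> P" "v [^] p = \<one>" "\<And>x. x \<in> P \<Longrightarrow> x \<otimes> v = v \<otimes> x" for v
    using that unfolding W_def by blast
  show "W \<lhd> G"
    unfolding normal_inv_iff
  proof (intro conjI ballI)
    show "subgroup W G"
    proof (rule subgroupI)
      show "W \<subseteq> carrier G" using W_def P.subset by auto
      have "\<one> \<in> W" unfolding W_def by (simp add: P.one_closed)
      then show "W \<noteq> {}" by blast
      fix v assume v: "v \<in> W"
      then have vG: "v \<in> carrier G" by (auto simp: W_def)
      have "x \<otimes> inv v = inv v \<otimes> x" if x: "x \<in> P" for x
      proof -
        have "v \<otimes> x = x \<otimes> v" using cW[OF x v] by simp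
        then show ?thesis using vG x
          by (metis P.mem_carrier inv_closed inv_solve_left inv_solve_right m_assoc m_closed)
      qed
      moreover have "inv v [^] p = \<one>" using WD(2)[OF v] vG by (simp add: nat_pow_inv)
      ultimately show "inv v \<in> W" using WD(1)[OF v] by (intro WI) auto
      fix w assume w: "w \<in> W"
      then have wG: "w \<in> carrier G" by (auto simp: W_def)
      have "v \<otimes> w = w \<otimes> v" using cW[OF WD(1)[OF v] w] .
      then have "(v \<otimes> w) [^] p = v [^] p \<otimes> w [^] p" using vG wG pow_mult_distrib by blast
      then have "(v \<otimes> w) [^] p = \<one>" using WD(2) v w by simp
      moreover have "x \<otimes> (v \<otimes> w) = v \<otimes> w \<otimes> x" if x: "x \<in> P" for x
      proof -
        have xG: "x \<in> carrier G" using x P.mem_carrier by simp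
        have "x \<otimes> (v \<otimes> w) = v \<otimes> (x \<otimes> w)"
          using cW[OF x v] xG vG wG by (simp flip: m_assoc)
        then show ?thesis using cW[OF x w] xG vG wG by (simp add: m_assoc)
      qed
      ultimately show "v \<otimes> w \<in> W" using WD(1)[OF v] WD(1)[OF w] by (intro WI) auto
    qed
    fix g v assume g: "g \<in> carrier G" and v: "v \<in> W"
    then have vG: "v \<in> carrier G" by (auto simp: W_def)
    have "x \<otimes> (g \<otimes> v \<otimes> inv g) = g \<otimes> v \<otimes> inv g \<otimes> x" if x: "x \<in> P" for x
    proof -
      have xG: "x \<in> carrier G" using x by auto
      have e: "g \<otimes> (inv g \<otimes> t) = t" if "t \<in> carrier G" for t
        using g that by (simp flip: m_assoc)
      let ?y = "inv g \<otimes> x \<otimes> g"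
      have "?y \<in> P" using g x P.inv_op_closed1 by simp
      then have c: "?y \<otimes> v = v \<otimes> ?y" using cW v by blast
      have "x \<otimes> (g \<otimes> v \<otimes> inv g) = g \<otimes> (?y \<otimes> v) \<otimes> inv g"
        using g xG vG e by (simp add: m_assoc)
      also have "\<dots> = g \<otimes> v \<otimes> inv g \<otimes> x"
        unfolding c using g xG vG e by (simp add: m_assoc)
      finally show ?thesis .
    qed
    moreover have "(g \<otimes> v \<otimes> inv g) [^] p = \<one>" using WD(2)[OF v] vG g by (simp add: conj_nat_pow)
    moreover have "g \<otimes> v \<otimes> inv g \<in> P" using WD(1)[OF v] g P.inv_op_closed2 by blast
    ultimately show "g \<otimes> v \<otimes> inv g \<in> W" by (intro WI) auto
  qed
  interpret GP: group "G\<lparr>carrier := P\<rparr>" using P.subgroup_axioms subgroup_imp_group by blast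
  obtain z where z: "z \<in> P" "z \<noteq> \<one>" "\<forall>x\<in>P. x \<otimes> z = z \<otimes> x"
    using GP.exists_central_element[OF p, of n] card nt by (auto simp: Coset.order_def)
  have zG: "z \<in> carrier G" using z by auto
  have "z [^] (p ^ n) = \<one>"
    using GP.pow_order_eq_1[of z] z card nat_pow_consistent[of z "p ^ n" P] by (simp add: Coset.order_def)
  then obtain j where j: "z [^] (p ^ j) = \<one>" "\<And>i. i < j \<Longrightarrow> z [^] (p ^ i) \<noteq> \<one>"
    using exists_least_iff[of "\<lambda>j. z [^] (p ^ j) = \<one>"] by blast
  then have "j \<noteq> 0" using z zG by (auto intro!: Nat.gr0I)
  then obtain i where i: "j = Suc i" by (cases j) auto
  let ?w = "z [^] (p ^ i)"
  have "?w [^] p = \<one>" using j(1) zG i by (simp add: nat_pow_pow mult.commute)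
  moreover have "x \<otimes> z [^] (m::nat) = z [^] m \<otimes> x" if x: "x \<in> P" for x m
    using z(3) x zG by (induction m) (simp_all add: m_assoc[symmetric], simp add: m_assoc)
  moreover have "z [^] (m::nat) \<in> P" for m using z(1) by (induction m) auto
  ultimately have "?w \<in> W" by (intro WI) auto
  moreover have "?w \<noteq> \<one>" using j(2) i by simp
  ultimately show "W \<noteq> {\<one>}" by blast
qed

text \<open>If \<open>P\<close> is a nontrivial normal \<open>p\<close>-subgroup and \<open>G / P\<close> is abelian of exponent dividing
  \<open>p - 1\<close>, then some nontrivial cyclic subgroup is normal in \<open>G\<close>. Let \<open>U\<close> be minimal among the
  nontrivial normal subgroups of \<open>G\<close> inside the elementary abelian group \<open>W\<close> of central elements of
  \<open>P\<close> of order dividing \<open>p\<close>. As \<open>G\<close> acts on \<open>U\<close> through the abelian group \<open>G / P\<close>, each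
  eigenspace of each \<open>g\<close> in \<open>U\<close> is normal in \<open>G\<close>, hence trivial or all of \<open>U\<close>. There is an
  eigenvector, so every \<open>g\<close> acts on \<open>U\<close> as a power map.\<close>

lemma (in group) exists_cyclic_normal:
  assumes fin: "finite (carrier G)" and P: "P \<lhd> G" and p: "prime p" and card: "card P = p ^ n"
    and nt: "P \<noteq> {\<one>}"
    and comm: "\<And>x y. \<lbrakk>x \<in> carrier G; y \<in> carrier G\<rbrakk> \<Longrightarrow> x \<otimes> y \<otimes> inv x \<otimes> inv y \<in> P"
    and exp: "\<And>x. x \<in> carrier G \<Longrightarrow> x [^] (p - 1) \<in> P"
  shows "\<exists>a \<in> carrier G. a \<noteq> \<one> \<and> (\<forall>g \<in> carrier G. \<exists>k::nat. g \<otimes> a \<otimes> inv g = a [^] k)"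
proof -
  interpret P: normal P G by fact
  define W where "W = {v \<in> P. v [^] p = \<one> \<and> (\<forall>x\<in>P. x \<otimes> v = v \<otimes> x)}"
  have W: "W \<lhd> G" "W \<noteq> {\<one>}"
    unfolding W_def using central_exponent_subgroup[OF P p card nt] by blast+
  have WP: "W \<subseteq> P" by (auto simp: W_def)
  obtain U where U: "U \<lhd> G" "U \<noteq> {\<one>}" "U \<subseteq> W"
    and minU: "\<And>V. \<lbrakk>V \<lhd> G; V \<noteq> {\<one>}; V \<subseteq> W\<rbrakk> \<Longrightarrow> card U \<le> card V"
    using ex_has_least_nat[of "\<lambda>V. V \<lhd> G \<and> V \<noteq> {\<one>} \<and> V \<subseteq> W" W card] W by blast
  interpret U: normal U G by fact
  have UP: "U \<subseteq> P" using U WP by blast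
  have finU: "finite U" using fin finite_subset[OF U.subset] by blast
  have cen: "x \<otimes> v = v \<otimes> x" if "x \<in> P" "v \<in> U" for x v
    using that U(3) by (auto simp: W_def)
  let ?U = "G\<lparr>carrier := U\<rparr>"
  interpret GU: comm_group ?U
  proof -
    interpret GU: group ?U using U.subgroup_axioms subgroup_imp_group by blast
    show "comm_group ?U" by unfold_locales (use cen UP in auto)
  qed
  have "\<exists>k::nat. \<forall>v\<in>U. g \<otimes> v \<otimes> inv g = v [^] k" if g: "g \<in> carrier G" for g
  proof -
    let ?T = "\<lambda>x. g \<otimes> x \<otimes> inv g"
    have TU: "?T x \<in> U" if "x \<in> U" for x using that g U.inv_op_closed2 by blast
    have T: "?T \<in> hom ?U ?U"
    proof (rule homI)
      fix x y assume "x \<in> carrier ?U" "y \<in> carrier ?U"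
      then have xy: "x \<in> carrier G" "y \<in> carrier G" by auto
      have "inv g \<otimes> (g \<otimes> t) = t" if "t \<in> carrier G" for t
        using g that by (simp flip: m_assoc)
      then show "?T (x \<otimes>\<^bsub>?U\<^esub> y) = ?T x \<otimes>\<^bsub>?U\<^esub> ?T y" using g xy by (simp add: m_assoc)
    qed (use TU in simp)
    obtain v where v: "v \<in> U" "v \<noteq> \<one>" using U(2) U.one_closed by blast
    have "g [^] (p - 1) \<otimes> v = v \<otimes> g [^] (p - 1)" using cen exp[OF g] v by blast
    then have Tv: "(?T ^^ (p - 1)) v = v"
      using conj_funpow[OF g, of v "p - 1"] g v by (simp add: m_assoc)
    have "\<exists>u k. u \<in> U \<and> u \<noteq> \<one> \<and> ?T u = u [^]\<^bsub>?U\<^esub> (k::nat)"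
      using GU.exists_eigenvector[OF T _ _ p _ Tv] v U(3) nat_pow_consistent
      by (auto simp: W_def subset_iff)
    then obtain u and k :: nat where u: "u \<in> U" "u \<noteq> \<one>" "?T u = u [^] k"
      by (metis nat_pow_consistent)
    \<comment> \<open>the eigenspace of \<open>g\<close> to which the eigenvector \<open>u\<close> belongs\<close>
    define V where "V = {v \<in> U. ?T v = v [^] k}"
    have "V \<lhd> G" unfolding normal_inv_iff
    proof (intro conjI ballI)
      show "subgroup V G"
      proof (rule subgroupI)
        show "V \<subseteq> carrier G" by (auto simp: V_def)
        show "V \<noteq> {}" using u by (auto simp: V_def)
        fix x assume x: "x \<in> V"
        then have xG: "x \<in> carrier G" by (auto simp: V_def)
        have "?T (inv x) = inv (?T x)" using xG g by (simp add: inv_mult_group m_assoc)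
        then show "inv x \<in> V" using x xG by (simp add: V_def nat_pow_inv)
        fix y assume y: "y \<in> V"
        then have yG: "y \<in> carrier G" by (auto simp: V_def)
        have "x \<otimes> y = y \<otimes> x" using cen x y UP by (auto simp: V_def)
        then have "(x \<otimes> y) [^] k = x [^] k \<otimes> y [^] k" using xG yG pow_mult_distrib by blast
        moreover have "?T (x \<otimes> y) = ?T x \<otimes> ?T y" using hom_mult[OF T] x y by (simp add: V_def)
        ultimately show "x \<otimes> y \<in> V" using x y by (simp add: V_def)
      qed
      fix h v assume h: "h \<in> carrier G" and v: "v \<in> V"
      then have vG: "v \<in> carrier G" and vU: "v \<in> U" by (auto simp: V_def)
      let ?c = "g \<otimes> h \<otimes> inv g \<otimes> inv h"
      let ?w = "h \<otimes> (g \<otimes> v \<otimes> inv g) \<otimes> inv h"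
      have wU: "?w \<in> U" using h g vU U.inv_op_closed2 by blast
      have cP: "?c \<in> P" using comm g h by blast
      have cG: "?c \<in> carrier G" using g h by simp
      \<comment> \<open>\<open>g\<close> and \<open>h\<close> commute up to an element of \<open>P\<close>, which acts trivially on \<open>U\<close>\<close>
      have gh: "g \<otimes> h = ?c \<otimes> (h \<otimes> g)"
      proof -
        have "inv h \<otimes> (h \<otimes> t) = t" "inv g \<otimes> (g \<otimes> t) = t" if "t \<in> carrier G" for t
          using g h that by (simp_all flip: m_assoc)
        then show ?thesis using g h by (simp add: m_assoc)
      qed
      have "?T (h \<otimes> v \<otimes> inv h) = (g \<otimes> h) \<otimes> v \<otimes> inv (g \<otimes> h)"
        using g h vG by (simp add: m_assoc inv_mult_group)
      also have "\<dots> = ?c \<otimes> (h \<otimes> g) \<otimes> v \<otimes> inv (?c \<otimes> (h \<otimes> g))"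
        by (rule arg_cong[OF gh, of "\<lambda>t. t \<otimes> v \<otimes> inv t"])
      also have "\<dots> = ?c \<otimes> ?w \<otimes> inv ?c"
      proof -
        have "c \<otimes> (h \<otimes> g) \<otimes> v \<otimes> inv (c \<otimes> (h \<otimes> g)) = c \<otimes> ?w \<otimes> inv c" if "c \<in> carrier G" for c
          using that g h vG by (simp add: m_assoc inv_mult_group)
        then show ?thesis using cG by blast
      qed
      also have "\<dots> = ?w"
        using cen[OF cP wU] cG U.mem_carrier[OF wU] by (metis inv_solve_right m_closed)
      also have "\<dots> = (h \<otimes> v \<otimes> inv h) [^] k"
        using v h vG conj_nat_pow[OF h vG] by (simp add: V_def)
      finally show "h \<otimes> v \<otimes> inv h \<in> V" using h vU U.inv_op_closed2 by (simp add: V_def)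
    qed
    moreover have "V \<noteq> {\<one>}" using u by (auto simp: V_def)
    moreover have "V \<subseteq> U" by (auto simp: V_def)
    ultimately have "V = U" using minU[of V] U(3) finU by (meson card_seteq subset_trans)
    then show ?thesis by (auto simp: V_def)
  qed
  moreover obtain a where "a \<in> U" "a \<noteq> \<one>" using U(2) U.one_closed by blast
  ultimately show ?thesis using U.subset by (metis subsetD)
qed

section \<open>Groups in the varieties H_p are supersolvable\<close>

lemma (in normal) variety_Ab_FactGroup_iff:
  assumes "finite (carrier (G Mod H))"
  shows "variety_Ab d (G Mod H) \<longleftrightarrow>
    (\<forall>x\<in>carrier G. \<forall>y\<in>carrier G. x \<otimes> y \<otimes> inv x \<otimes> inv y \<in> H) \<and> (\<forall>x\<in>carrier G. x [^] d \<in> H)"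
proof -
  let ?Q = "G Mod H"
  interpret Q: group ?Q by (rule factorgroup_is_group)
  interpret h: group_hom G ?Q "\<lambda>x. H #> x" by (rule r_coset_group_hom)
  have com: "x \<otimes> y \<otimes> inv x \<otimes> inv y \<in> H \<longleftrightarrow> (H #> x) \<otimes>\<^bsub>?Q\<^esub> (H #> y) = (H #> y) \<otimes>\<^bsub>?Q\<^esub> (H #> x)"
    if "x \<in> carrier G" "y \<in> carrier G" for x y
  proof -
    have "x \<otimes> y \<otimes> inv x \<otimes> inv y = (x \<otimes> y) \<otimes> inv (y \<otimes> x)"
      using that by (simp add: m_assoc inv_mult_group)
    then show ?thesis using that rcos_eq_iff[of "x \<otimes> y" "y \<otimes> x"] by (simp only: h.hom_mult m_closed)
  qed
  have pow: "x [^] d \<in> H \<longleftrightarrow> (H #> x) [^]\<^bsub>?Q\<^esub> d = \<one>\<^bsub>?Q\<^esub>" if "x \<in> carrier G" for x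
    using that by (simp add: FactGroup_pow rcos_eq_one_iff)
  have "comm_group ?Q \<longleftrightarrow> (\<forall>x\<in>carrier G. \<forall>y\<in>carrier G. x \<otimes> y \<otimes> inv x \<otimes> inv y \<in> H)" (is "_ = ?C")
  proof
    assume "comm_group ?Q"
    then interpret Qc: comm_group ?Q .
    show ?C using com Qc.m_comm h.hom_closed by blast
  next
    assume ?C
    show "comm_group ?Q"
    proof (rule Q.group_comm_groupI)
      fix X Y assume "X \<in> carrier ?Q" "Y \<in> carrier ?Q"
      then obtain x y where "x \<in> carrier G" "y \<in> carrier G" "X = H #> x" "Y = H #> y"
        by (auto simp: carrier_FactGroup)
      then show "X \<otimes>\<^bsub>?Q\<^esub> Y = Y \<otimes>\<^bsub>?Q\<^esub> X" using com \<open>?C\<close> by blast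
    qed
  qed
  moreover have "(\<forall>X\<in>carrier ?Q. X [^]\<^bsub>?Q\<^esub> d = \<one>\<^bsub>?Q\<^esub>) \<longleftrightarrow> (\<forall>x\<in>carrier G. x [^] d \<in> H)"
    using pow by (simp add: carrier_FactGroup)
  ultimately show ?thesis unfolding variety_Ab_def using assms by blast
qed

text \<open>Membership in \<open>\<^bold>H\<^sub>p\<close> in terms of elements of \<open>G\<close> alone, without a quotient group.\<close>

lemma variety_H_iff:
  assumes "group G" "finite (carrier G)"
  shows "variety_H p G \<longleftrightarrow> (\<exists>N. N \<lhd> G \<and> (\<exists>k. card N = p ^ k) \<and>
    (\<forall>x\<in>carrier G. \<forall>y\<in>carrier G. x \<otimes>\<^bsub>G\<^esub> y \<otimes>\<^bsub>G\<^esub> inv\<^bsub>G\<^esub> x \<otimes>\<^bsub>G\<^esub> inv\<^bsub>G\<^esub> y \<in> N) \<and>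
    (\<forall>x\<in>carrier G. x [^]\<^bsub>G\<^esub> (p - 1) \<in> N))"
proof -
  interpret group G by fact
  have "variety_G p (G\<lparr>carrier := N\<rparr>) \<longleftrightarrow> (\<exists>k. card N = p ^ k)" if "N \<lhd> G" for N
  proof -
    interpret normal N G by fact
    have "finite N" using assms(2) subset finite_subset by blast
    moreover have "group (G\<lparr>carrier := N\<rparr>)" using subgroup_axioms subgroup_imp_group by blast
    ultimately show ?thesis by (simp add: variety_G_def Coset.order_def)
  qed
  moreover have "finite (carrier (G Mod N))" for N
    using assms(2) by (simp add: carrier_FactGroup)
  ultimately show ?thesis
    unfolding variety_H_def variety_product_def using assms normal.variety_Ab_FactGroup_iff by blast
qed

text \<open>A finite group with a normal \<open>p\<close>-subgroup \<open>N\<close> whose quotient is abelian of exponent dividing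
  \<open>p - 1\<close> is supersolvable. Every normal \<open>M \<noteq> G\<close> is properly contained in a normal subgroup that
  is cyclic over \<open>M\<close>: if \<open>N \<subseteq> M\<close>, any element outside \<open>M\<close> generates one, as \<open>G / M\<close> is abelian;
  otherwise the image of \<open>N\<close> in \<open>G / M\<close> is a nontrivial \<open>p\<close>-group.\<close>

lemma (in group) prime_series_of_p_by_abelian:
  assumes fin: "finite (carrier G)" and N: "N \<lhd> G" and p: "prime p" and card: "card N = p ^ n"
    and comm: "\<And>x y. \<lbrakk>x \<in> carrier G; y \<in> carrier G\<rbrakk> \<Longrightarrow> x \<otimes> y \<otimes> inv x \<otimes> inv y \<in> N"
    and exp: "\<And>x. x \<in> carrier G \<Longrightarrow> x [^] (p - 1) \<in> N"
    and M: "M \<lhd> G"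
  shows "prime_series G M"
  using M
proof (induction "card (carrier G) - card M" arbitrary: M rule: less_induct)
  case less
  interpret M: normal M G by fact
  interpret N: normal N G by fact
  show ?case
  proof (cases "M = carrier G")
    case True
    then show ?thesis by (simp add: prime_series.top)
  next
    case False
    let ?Q = "G Mod M"
    interpret Q: group ?Q by (rule M.factorgroup_is_group)
    interpret h: group_hom G ?Q "\<lambda>x. M #> x" by (rule M.r_coset_group_hom)
    have surj: "(\<lambda>x. M #> x) ` carrier G = carrier ?Q" by (simp add: carrier_FactGroup)
    have "\<exists>a \<in> carrier G. a \<notin> M \<and> (\<forall>g\<in>carrier G. g \<otimes> a \<otimes> inv g \<in> cyclic_over G M a)"
    proof (cases "N \<subseteq> M")
      case True
      obtain a where a: "a \<in> carrier G" "a \<notin> M" using False M.subset by blast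
      have "g \<otimes> a \<otimes> inv g \<in> cyclic_over G M a" if g: "g \<in> carrier G" for g
      proof -
        have "g \<otimes> a \<otimes> inv g \<otimes> inv a \<in> M" using comm[OF g a(1)] True by blast
        then have "g \<otimes> a \<otimes> inv g \<in> M #> a [^] (1::nat)"
          using M.rcos_module[OF is_group] g a by simp
        then show ?thesis unfolding cyclic_over_def using g a(1) by blast
      qed
      then show ?thesis using a by blast
    next
      case F: False
      let ?P = "(\<lambda>x. M #> x) ` N"
      have P: "?P \<lhd> ?Q" using N.surj_hom_normal_subgroup[OF h.group_hom_axioms surj] .
      interpret P: normal ?P ?Q by fact
      have finQ: "finite (carrier ?Q)" using fin surj by (metis finite_imageI)
      interpret GP: group "?Q\<lparr>carrier := ?P\<rparr>" using P.subgroup_axioms Q.subgroup_imp_group by blast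
      interpret GN: group "G\<lparr>carrier := N\<rparr>" using N.subgroup_axioms subgroup_imp_group by blast
      have "\<exists>k. Coset.order (?Q\<lparr>carrier := ?P\<rparr>) = p ^ k"
      proof (rule GP.order_eq_prime_power[OF _ p])
        show "finite (carrier (?Q\<lparr>carrier := ?P\<rparr>))" using finQ P.subset finite_subset by auto
        fix X assume "X \<in> carrier (?Q\<lparr>carrier := ?P\<rparr>)"
        then obtain x where x: "x \<in> N" "X = M #> x" by auto
        have "x [^] (p ^ n) = \<one>" using GN.pow_order_eq_1[of x] x card nat_pow_consistent[of x "p ^ n" N]
          by (simp add: Coset.order_def)
        then have "X [^]\<^bsub>?Q\<^esub> (p ^ n) = \<one>\<^bsub>?Q\<^esub>" using x by (simp add: M.FactGroup_pow M.rcos_eq_one_iff)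
        then show "\<exists>k. X [^]\<^bsub>?Q\<lparr>carrier := ?P\<rparr>\<^esub> (p ^ k) = \<one>\<^bsub>?Q\<lparr>carrier := ?P\<rparr>\<^esub>"
          using Q.nat_pow_consistent[of X "p ^ n" ?P] by auto
      qed
      then obtain k where k: "card ?P = p ^ k" by (auto simp: Coset.order_def)
      obtain y where y: "y \<in> N" "y \<notin> M" using F by blast
      then have "M #> y \<noteq> \<one>\<^bsub>?Q\<^esub>" using M.rcos_eq_one_iff by simp
      then have nt: "?P \<noteq> {\<one>\<^bsub>?Q\<^esub>}" using y by blast
      have "\<exists>A \<in> carrier ?Q. A \<noteq> \<one>\<^bsub>?Q\<^esub> \<and>
        (\<forall>g \<in> carrier ?Q. \<exists>k::nat. g \<otimes>\<^bsub>?Q\<^esub> A \<otimes>\<^bsub>?Q\<^esub> inv\<^bsub>?Q\<^esub> g = A [^]\<^bsub>?Q\<^esub> k)"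
      proof (rule Q.exists_cyclic_normal[OF finQ P p k nt])
        fix X Y assume "X \<in> carrier ?Q" "Y \<in> carrier ?Q"
        then obtain x y where xy: "x \<in> carrier G" "y \<in> carrier G" "X = M #> x" "Y = M #> y"
          by (auto simp: carrier_FactGroup)
        then have "X \<otimes>\<^bsub>?Q\<^esub> Y \<otimes>\<^bsub>?Q\<^esub> inv\<^bsub>?Q\<^esub> X \<otimes>\<^bsub>?Q\<^esub> inv\<^bsub>?Q\<^esub> Y = M #> (x \<otimes> y \<otimes> inv x \<otimes> inv y)"
          by (simp only: h.hom_mult h.hom_inv m_closed inv_closed)
        then show "X \<otimes>\<^bsub>?Q\<^esub> Y \<otimes>\<^bsub>?Q\<^esub> inv\<^bsub>?Q\<^esub> X \<otimes>\<^bsub>?Q\<^esub> inv\<^bsub>?Q\<^esub> Y \<in> ?P" using comm xy by blast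
      next
        fix X assume "X \<in> carrier ?Q"
        then obtain x where x: "x \<in> carrier G" "X = M #> x" by (auto simp: carrier_FactGroup)
        then show "X [^]\<^bsub>?Q\<^esub> (p - 1) \<in> ?P" using exp[of x] by (simp add: M.FactGroup_pow)
      qed
      then obtain a where a: "a \<in> carrier G" "M #> a \<noteq> \<one>\<^bsub>?Q\<^esub>"
        and c: "\<And>g. g \<in> carrier ?Q \<Longrightarrow>
          \<exists>k::nat. g \<otimes>\<^bsub>?Q\<^esub> (M #> a) \<otimes>\<^bsub>?Q\<^esub> inv\<^bsub>?Q\<^esub> g = (M #> a) [^]\<^bsub>?Q\<^esub> k"
        unfolding surj[symmetric] by blast
      have "g \<otimes> a \<otimes> inv g \<in> cyclic_over G M a" if g: "g \<in> carrier G" for g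
      proof -
        have "M #> (g \<otimes> a \<otimes> inv g) = (M #> g) \<otimes>\<^bsub>?Q\<^esub> (M #> a) \<otimes>\<^bsub>?Q\<^esub> inv\<^bsub>?Q\<^esub> (M #> g)"
          using g a by (simp only: h.hom_mult h.hom_inv m_closed inv_closed)
        then show ?thesis using M.in_cyclic_over_iff[OF a(1)] c[of "M #> g"] g a(1) by force
      qed
      moreover have "a \<notin> M" using a M.rcos_eq_one_iff by auto
      ultimately show ?thesis using a by blast
    qed
    then obtain a where a: "a \<in> carrier G" "a \<notin> M"
      and c: "\<And>g. g \<in> carrier G \<Longrightarrow> g \<otimes> a \<otimes> inv g \<in> cyclic_over G M a" by blast
    have o: "a [^] Coset.order G \<in> M" "Coset.order G > 0"
      using a fin order_gt_0_iff_finite by (simp_all add: pow_order_eq_1)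
    let ?N = "cyclic_over G M a"
    have Nn: "?N \<lhd> G" by (rule M.cyclic_over_normal[OF a(1) o c])
    have "M \<subseteq> ?N" unfolding cyclic_over_def using M.subset by (auto intro!: exI[of _ "0::nat"])
    moreover have "a \<in> ?N" unfolding cyclic_over_def using a rcos_self[OF a(1) M.subgroup_axioms]
      by (auto intro!: exI[of _ "1::nat"])
    ultimately have "M \<subset> ?N" using a by blast
    moreover have "?N \<subseteq> carrier G" by (auto simp: cyclic_over_def)
    ultimately have "card M < card ?N" "card ?N \<le> card (carrier G)"
      using fin by (auto intro: psubset_card_mono card_mono finite_subset)
    then have "prime_series G ?N" using less(1)[OF _ Nn] by simp
    then show ?thesis using prime_series_cyclic_step[OF _ less(2) a(1) o c] by blast
  qed
qed

section \<open>Supersolvable groups whose normal subgroups of prime order have the same order\<close>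

lemma (in group) normal_of_commutators:
  assumes "subgroup Z G"
    and "\<And>x y. \<lbrakk>x \<in> carrier G; y \<in> carrier G\<rbrakk> \<Longrightarrow> x \<otimes> y \<otimes> inv x \<otimes> inv y \<in> Z"
  shows "Z \<lhd> G"
  unfolding normal_inv_iff
proof (intro conjI ballI assms(1))
  interpret subgroup Z G by fact
  fix g h assume g: "g \<in> carrier G" and h: "h \<in> Z"
  have "g \<otimes> h \<otimes> inv g = (g \<otimes> h \<otimes> inv g \<otimes> inv h) \<otimes> h" using g h by (simp add: m_assoc)
  then show "g \<otimes> h \<otimes> inv g \<in> Z"
    using subgroup.m_closed[OF assms(1) assms(2)[OF g mem_carrier[OF h]] h] by argo
qed

text \<open>The automorphism group of a cyclic group of order \<open>p\<close> is abelian of exponent dividing \<open>p - 1\<close>,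
  and \<open>G\<close> modulo the centralizer of a normal cyclic subgroup of order \<open>p\<close> embeds into it.\<close>

lemma (in group) centralizer_of_cyclic_normal:
  assumes c: "c \<in> carrier G" "c [^] p = \<one>" and p: "prime (p::nat)"
    and conj: "\<And>g. g \<in> carrier G \<Longrightarrow> \<exists>k::nat. g \<otimes> c \<otimes> inv g = c [^] k"
  defines "Z \<equiv> {g \<in> carrier G. g \<otimes> c \<otimes> inv g = c}"
  shows "Z \<lhd> G" "\<And>x y. \<lbrakk>x \<in> carrier G; y \<in> carrier G\<rbrakk> \<Longrightarrow> x \<otimes> y \<otimes> inv x \<otimes> inv y \<in> Z"
    "\<And>x. x \<in> carrier G \<Longrightarrow> x [^] (p - 1) \<in> Z"
proof -
  let ?cj = "\<lambda>g x. g \<otimes> x \<otimes> inv g"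
  have cj_mult: "?cj (g \<otimes> h) x = ?cj g (?cj h x)"
    if "g \<in> carrier G" "h \<in> carrier G" "x \<in> carrier G" for g h x
    using that by (simp add: m_assoc inv_mult_group)
  have cj_inv: "?cj (inv g) (?cj g x) = x" if "g \<in> carrier G" "x \<in> carrier G" for g x
    using that cj_mult[of "inv g" g x] by simp
  have sub: "subgroup Z G"
  proof (rule subgroupI)
    show "Z \<subseteq> carrier G" by (auto simp: Z_def)
    have "\<one> \<in> Z" using c by (simp add: Z_def)
    then show "Z \<noteq> {}" by blast
    fix g assume g: "g \<in> Z"
    then show "inv g \<in> Z" using cj_inv[of g c] c by (simp add: Z_def)
    fix h assume "h \<in> Z"
    then show "g \<otimes> h \<in> Z" using g cj_mult[of g h c] c by (simp add: Z_def)
  qed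
  show com: "x \<otimes> y \<otimes> inv x \<otimes> inv y \<in> Z" if x: "x \<in> carrier G" and y: "y \<in> carrier G" for x y
  proof -
    let ?a = "inv x" and ?b = "inv y"
    obtain k l :: nat where k: "?cj ?a c = c [^] k" and l: "?cj ?b c = c [^] l"
      using conj x y by (metis inv_closed)
    have "?cj (?a \<otimes> ?b) c = (c [^] k) [^] l"
      using x y c k l by (simp only: cj_mult inv_closed flip: conj_nat_pow)
    moreover have "?cj (?b \<otimes> ?a) c = (c [^] l) [^] k"
      using x y c k l by (simp only: cj_mult inv_closed flip: conj_nat_pow)
    ultimately have eq: "?cj (?a \<otimes> ?b) c = ?cj (?b \<otimes> ?a) c"
      using c by (simp add: nat_pow_pow mult.commute)
    have "x \<otimes> y \<otimes> inv x \<otimes> inv y = inv (?b \<otimes> ?a) \<otimes> (?a \<otimes> ?b)"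
      using x y by (simp add: m_assoc inv_mult_group)
    then have "?cj (x \<otimes> y \<otimes> inv x \<otimes> inv y) c = ?cj (inv (?b \<otimes> ?a)) (?cj (?a \<otimes> ?b) c)"
      using x y c cj_mult[of "inv (?b \<otimes> ?a)" "?a \<otimes> ?b" c] by (simp only: m_closed inv_closed)
    also have "\<dots> = c" unfolding eq using x y c by (intro cj_inv) auto
    finally show ?thesis using x y by (simp add: Z_def)
  qed
  show "Z \<lhd> G" using normal_of_commutators[OF sub com] .
  show "x [^] (p - 1) \<in> Z" if x: "x \<in> carrier G" for x
  proof -
    obtain k :: nat where k: "?cj x c = c [^] k" using conj x by blast
    have it: "?cj (x [^] n) c = c [^] (k ^ n)" for n :: nat
    proof (induction n)
      case (Suc n)
      have "?cj (x [^] Suc n) c = ?cj x (?cj (x [^] n) c)"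
        using x c cj_mult[of x "x [^] n" c] by (simp only: nat_pow_Suc2 nat_pow_closed)
      also have "\<dots> = (c [^] k) [^] (k ^ n)" unfolding Suc using x c k conj_nat_pow[of x c "k ^ n"] by simp
      finally show ?case using c by (simp add: nat_pow_pow)
    qed (use c in simp)
    show ?thesis
    proof (cases "p dvd k")
      case True
      then have "c [^] k = c [^] (0::nat)" by (intro pow_mod_of_pow_one[OF c]) (simp add: cong_0_iff)
      then have "x \<otimes> c \<otimes> inv x = \<one>" using k by simp
      then have "c = \<one>" using cj_inv[of x c] x c by simp
      then show ?thesis using x by (simp add: Z_def)
    next
      case False
      then have "[k ^ (p - 1) = 1] (mod p)" using fermat_theorem p by blast
      then have "c [^] (k ^ (p - 1)) = c [^] (1::nat)" by (rule pow_mod_of_pow_one[OF c])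
      then show ?thesis using it[of "p - 1"] c x by (simp add: Z_def)
    qed
  qed
qed

text \<open>A \<open>p\<close>-element has order a power of \<open>p\<close>; in a \<open>p\<close>-regular element the order is prime to \<open>p\<close>.
  The exponent \<open>n\<close> below is nonzero, because \<open>0\<close> is not coprime to a prime \<open>p\<close>.\<close>

definition p_element :: "('a, 'b) monoid_scheme \<Rightarrow> nat \<Rightarrow> 'a \<Rightarrow> bool" where
  "p_element G p x \<longleftrightarrow> (\<exists>k. x [^]\<^bsub>G\<^esub> (p ^ k) = \<one>\<^bsub>G\<^esub>)"

definition p_regular :: "('a, 'b) monoid_scheme \<Rightarrow> nat \<Rightarrow> 'a \<Rightarrow> bool" where
  "p_regular G p x \<longleftrightarrow> (\<exists>n. coprime n p \<and> x [^]\<^bsub>G\<^esub> n = \<one>\<^bsub>G\<^esub>)"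

lemma (in group) p_element_eq_one:
  assumes "x \<in> carrier G" "p_element G p x" "x [^] n = \<one>" "coprime n p"
  shows "x = \<one>"
proof -
  obtain k where "x [^] (p ^ k) = \<one>" using assms by (auto simp: p_element_def)
  then show ?thesis using one_if_coprime_powers[OF assms(1) _ assms(3), of "p ^ k"] assms(4)
    by (simp add: coprime_commute)
qed

text \<open>\<open>a\<close> generates a normal subgroup of \<open>G\<close> of prime order \<open>q\<close>.\<close>

definition prime_order_normal :: "('a, 'b) monoid_scheme \<Rightarrow> nat \<Rightarrow> 'a \<Rightarrow> bool" where
  "prime_order_normal G q a \<longleftrightarrow> prime q \<and> a \<in> carrier G \<and> a \<noteq> \<one>\<^bsub>G\<^esub> \<and> a [^]\<^bsub>G\<^esub> q = \<one>\<^bsub>G\<^esub> \<and>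
     (\<forall>g\<in>carrier G. \<exists>k::nat. g \<otimes>\<^bsub>G\<^esub> a \<otimes>\<^bsub>G\<^esub> inv\<^bsub>G\<^esub> g = a [^]\<^bsub>G\<^esub> k)"

text \<open>The induction hypothesis for the descent along a prime series: a normal subgroup \<open>C\<close> of \<open>G\<close>
  inside \<open>D\<close> consists of \<open>p\<close>-elements as soon as \<open>C \<inter> M\<close> does and the \<open>p\<close>-regular elements of
  \<open>C\<close> centralize \<open>C \<inter> M\<close>. For \<open>M = G\<close> this holds with \<open>D = G\<close>; for \<open>M = 1\<close> it makes a normal \<open>D\<close>
  itself a \<open>p\<close>-group.\<close>

definition detects_p_groups :: "('a, 'b) monoid_scheme \<Rightarrow> nat \<Rightarrow> 'a set \<Rightarrow> 'a set \<Rightarrow> bool" where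
  "detects_p_groups G p M D \<longleftrightarrow>
     (\<forall>C. C \<lhd> G \<and> C \<subseteq> D \<and> (\<forall>z\<in>C \<inter> M. p_element G p z) \<and>
       (\<forall>z\<in>C \<inter> M. \<forall>y\<in>C. p_regular G p y \<longrightarrow> y \<otimes>\<^bsub>G\<^esub> z = z \<otimes>\<^bsub>G\<^esub> y) \<longrightarrow>
       (\<forall>z\<in>C. p_element G p z))"

text \<open>If \<open>N / M\<close> has order dividing \<open>p\<close>, then \<open>D\<close> is cut down to the elements that centralize
  \<open>N / M\<close>. A \<open>p\<close>-regular \<open>y \<in> C\<close> then moves \<open>z \<in> C \<inter> N\<close> to \<open>w z\<close> with \<open>w \<in> C \<inter> M\<close>, and
  \<open>y\<close> centralizes \<open>w\<close>; hence \<open>y\<^sup>n\<close> moves \<open>z\<close> to \<open>w\<^sup>n z\<close>. If \<open>y\<^sup>n = 1\<close>, then \<open>w\<^sup>n = 1\<close>, and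
  so \<open>w = 1\<close>, because \<open>w\<close> is a \<open>p\<close>-element.\<close>

lemma (in group) detects_p_groups_step_p:
  assumes det: "detects_p_groups G p N D" and M: "M \<lhd> G" and D: "D \<lhd> G"
    and p: "prime p" and a: "a \<in> N" "a [^] p \<in> M" and NM: "N \<subseteq> cyclic_over G M a"
    and N: "N \<lhd> G"
    and comm: "\<And>x y. \<lbrakk>x \<in> carrier G; y \<in> carrier G\<rbrakk> \<Longrightarrow> x \<otimes> y \<otimes> inv x \<otimes> inv y \<in> D"
    and exp: "\<And>x. x \<in> carrier G \<Longrightarrow> x [^] (p - 1) \<in> D"
  shows "\<exists>D'. D' \<lhd> G \<and>
    (\<forall>x\<in>carrier G. \<forall>y\<in>carrier G. x \<otimes> y \<otimes> inv x \<otimes> inv y \<in> D') \<and>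
    (\<forall>x\<in>carrier G. x [^] (p - 1) \<in> D') \<and> detects_p_groups G p M D'"
proof -
  interpret M: normal M G by fact
  interpret N: normal N G by fact
  let ?Q = "G Mod M"
  interpret Q: group ?Q by (rule M.factorgroup_is_group)
  interpret h: group_hom G ?Q "\<lambda>x. M #> x" by (rule M.r_coset_group_hom)
  have aG: "a \<in> carrier G" using a by simp
  define c where "c = M #> a"
  have c: "c \<in> carrier ?Q" "c [^]\<^bsub>?Q\<^esub> p = \<one>\<^bsub>?Q\<^esub>"
    using aG a by (auto simp: c_def M.FactGroup_pow M.rcos_eq_one_iff)
  have ex: "\<exists>k::nat. M #> z = c [^]\<^bsub>?Q\<^esub> k" if "z \<in> N" for z
    using NM that M.in_cyclic_over_iff[OF aG] c_def by blast
  have cj: "\<exists>k::nat. g \<otimes>\<^bsub>?Q\<^esub> c \<otimes>\<^bsub>?Q\<^esub> inv\<^bsub>?Q\<^esub> g = c [^]\<^bsub>?Q\<^esub> k" if gQ: "g \<in> carrier ?Q" for g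
  proof -
    obtain x where x: "x \<in> carrier G" "g = M #> x" using gQ by (auto simp: carrier_FactGroup)
    have "g \<otimes>\<^bsub>?Q\<^esub> c \<otimes>\<^bsub>?Q\<^esub> inv\<^bsub>?Q\<^esub> g = M #> (x \<otimes> a \<otimes> inv x)"
      using x aG unfolding c_def by (simp only: h.hom_mult h.hom_inv m_closed inv_closed)
    then show ?thesis using ex[of "x \<otimes> a \<otimes> inv x"] x a(1) N.inv_op_closed2 by simp
  qed
  define Z where "Z = {g \<in> carrier ?Q. g \<otimes>\<^bsub>?Q\<^esub> c \<otimes>\<^bsub>?Q\<^esub> inv\<^bsub>?Q\<^esub> g = c}"
  note Z = Q.centralizer_of_cyclic_normal[OF c p cj, folded Z_def]
  let ?Z = "{x \<in> carrier G. M #> x \<in> Z}"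
  have "?Z \<lhd> G" using h.normal_preimage[OF Z(1)] .
  then have norm: "D \<inter> ?Z \<lhd> G" using D normal_subgroup_intersect by blast
  have comm': "x \<otimes> y \<otimes> inv x \<otimes> inv y \<in> D \<inter> ?Z" if "x \<in> carrier G" "y \<in> carrier G" for x y
  proof -
    have "M #> (x \<otimes> y \<otimes> inv x \<otimes> inv y) =
      (M #> x) \<otimes>\<^bsub>?Q\<^esub> (M #> y) \<otimes>\<^bsub>?Q\<^esub> inv\<^bsub>?Q\<^esub> (M #> x) \<otimes>\<^bsub>?Q\<^esub> inv\<^bsub>?Q\<^esub> (M #> y)"
      using that by (simp only: h.hom_mult h.hom_inv m_closed inv_closed)
    moreover have "\<dots> \<in> Z" using that by (intro Z(2) h.hom_closed)
    ultimately show ?thesis using comm that by simp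
  qed
  have exp': "x [^] (p - 1) \<in> D \<inter> ?Z" if "x \<in> carrier G" for x
    using Z(3)[of "M #> x"] that exp[OF that] h.hom_closed[OF that] by (simp add: M.FactGroup_pow)
  have triv: "y \<otimes> z \<otimes> inv y \<otimes> inv z \<in> M" if y: "y \<in> ?Z" and z: "z \<in> N" for y z
  proof -
    have yG: "y \<in> carrier G" "z \<in> carrier G" using y z by auto
    obtain l :: nat where l: "M #> z = c [^]\<^bsub>?Q\<^esub> l" using ex z by blast
    have "M #> (y \<otimes> z \<otimes> inv y) = (M #> y) \<otimes>\<^bsub>?Q\<^esub> c [^]\<^bsub>?Q\<^esub> l \<otimes>\<^bsub>?Q\<^esub> inv\<^bsub>?Q\<^esub> (M #> y)"
      using yG l[symmetric] by (simp only: h.hom_mult h.hom_inv m_closed inv_closed)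
    also have "\<dots> = c [^]\<^bsub>?Q\<^esub> l"
      using Q.conj_nat_pow[of "M #> y" c l] y c(1) h.hom_closed yG(1) by (simp add: Z_def)
    finally have "M #> (y \<otimes> z \<otimes> inv y) = M #> z" using l by simp
    then show ?thesis using yG M.rcos_eq_iff[of "y \<otimes> z \<otimes> inv y" z] by simp
  qed
  have "detects_p_groups G p M (D \<inter> ?Z)"
    unfolding detects_p_groups_def
  proof (intro allI impI, elim conjE)
    fix C assume C: "C \<lhd> G" "C \<subseteq> D \<inter> ?Z" and tor: "\<forall>z\<in>C \<inter> M. p_element G p z"
      and cen: "\<forall>z\<in>C \<inter> M. \<forall>y\<in>C. p_regular G p y \<longrightarrow> y \<otimes> z = z \<otimes> y"
    interpret C: normal C G by fact
    have tor': "p_element G p z" if z: "z \<in> C \<inter> N" for z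
    proof -
      have zG: "z \<in> carrier G" using z by auto
      obtain l :: nat where l: "M #> z = c [^]\<^bsub>?Q\<^esub> l" using ex z by blast
      have "M #> z [^] p = (c [^]\<^bsub>?Q\<^esub> l) [^]\<^bsub>?Q\<^esub> p" using l zG by (simp flip: M.FactGroup_pow)
      also have "\<dots> = (c [^]\<^bsub>?Q\<^esub> p) [^]\<^bsub>?Q\<^esub> l" using c(1) by (simp only: Q.nat_pow_pow mult.commute)
      also have "\<dots> = M" using c(2) by (metis Q.nat_pow_one one_FactGroup)
      finally have "z [^] p \<in> M" using zG M.rcos_eq_one_iff by simp
      moreover have "z [^] (n::nat) \<in> C" for n using z by (induction n) auto
      ultimately have "p_element G p (z [^] p)" using tor by blast
      then obtain k where "(z [^] p) [^] (p ^ k) = \<one>" by (auto simp: p_element_def)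
      then have "z [^] (p ^ Suc k) = \<one>" using zG by (simp add: nat_pow_pow)
      then show ?thesis unfolding p_element_def by blast
    qed
    have cen': "y \<otimes> z = z \<otimes> y" if z: "z \<in> C \<inter> N" and y: "y \<in> C" "p_regular G p y" for y z
    proof -
      have G: "y \<in> carrier G" "z \<in> carrier G" using z y by auto
      define w where "w = y \<otimes> z \<otimes> inv y \<otimes> inv z"
      have wG: "w \<in> carrier G" using G by (simp add: w_def)
      have "w \<in> M" unfolding w_def using triv[of y z] y z C(2) by blast
      moreover have wC: "w \<in> C" unfolding w_def using y z by simp
      ultimately have "y \<otimes> w = w \<otimes> y" and wt: "p_element G p w" using tor cen y by auto
      have yz: "y \<otimes> z = w \<otimes> z \<otimes> y" unfolding w_def using G by (simp add: m_assoc)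
      have ywk: "y \<otimes> w [^] (k::nat) = w [^] k \<otimes> y" for k
      proof (induction k)
        case (Suc k)
        have "y \<otimes> w [^] Suc k = (y \<otimes> w [^] k) \<otimes> w" using G wG by (simp add: m_assoc)
        also have "\<dots> = w [^] k \<otimes> (y \<otimes> w)" unfolding Suc using G wG by (simp add: m_assoc)
        also have "\<dots> = w [^] Suc k \<otimes> y" unfolding \<open>y \<otimes> w = w \<otimes> y\<close> using G wG by (simp add: m_assoc)
        finally show ?case .
      qed (use G in simp)
      have it: "y [^] k \<otimes> z = w [^] k \<otimes> z \<otimes> y [^] k" for k :: nat
      proof (induction k)
        case (Suc k)
        have "y [^] Suc k \<otimes> z = y \<otimes> (y [^] k \<otimes> z)" using G by (simp only: nat_pow_Suc2 m_assoc nat_pow_closed)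
        also have "\<dots> = (y \<otimes> w [^] k) \<otimes> (z \<otimes> y [^] k)" unfolding Suc using G wG by (simp add: m_assoc)
        also have "\<dots> = w [^] k \<otimes> (y \<otimes> z) \<otimes> y [^] k" unfolding ywk using G wG by (simp add: m_assoc)
        also have "\<dots> = w [^] Suc k \<otimes> z \<otimes> (y \<otimes> y [^] k)" unfolding yz using G wG by (simp add: m_assoc)
        also have "y \<otimes> y [^] k = y [^] Suc k" using G by (simp only: nat_pow_Suc2)
        finally show ?case .
      qed (use G in simp)
      obtain n where n: "coprime n p" "y [^] n = \<one>" using y by (auto simp: p_regular_def)
      have "z = w [^] n \<otimes> z" using it[of n] n G wG by simp
      then have "w [^] n = \<one>" using G wG by (metis nat_pow_closed r_cancel_one')
      then have "w = \<one>" using p_element_eq_one[OF wG wt] n by blast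
      then show ?thesis using yz G by simp
    qed
    show "\<forall>z\<in>C. p_element G p z"
      using det[unfolded detects_p_groups_def, rule_format, of C] C tor' cen' by blast
  qed
  then show ?thesis using norm comm' exp' by blast
qed

text \<open>If \<open>N / M\<close> has order dividing a prime \<open>q \<noteq> p\<close>, then \<open>D\<close> is kept, because \<open>C \<inter> N \<subseteq> M\<close>.
  Otherwise \<open>C \<inter> N\<close> contains a \<open>p\<close>-regular element \<open>x\<close> outside \<open>M\<close>, which has order \<open>q\<close>.
  A conjugate of \<open>x\<close> is \<open>u x\<^sup>k\<close> with \<open>u \<in> C \<inter> M\<close> commuting with \<open>x\<close>, so \<open>u\<^sup>q = 1\<close> and \<open>u = 1\<close>.
  Thus \<open>x\<close> generates a normal subgroup of order \<open>q\<close>, which \<open>min\<close> excludes.\<close>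

lemma (in group) detects_p_groups_step_other:
  assumes fin: "finite (carrier G)" and det: "detects_p_groups G p N D" and M: "M \<lhd> G"
    and p: "prime p" and q: "prime q" "q \<noteq> p"
    and a: "a \<in> N" "a [^] q \<in> M" and NM: "N \<subseteq> cyclic_over G M a" and N: "N \<lhd> G"
    and min: "\<And>b r. prime_order_normal G r b \<Longrightarrow> r = p"
  shows "detects_p_groups G p M D"
  unfolding detects_p_groups_def
proof (intro allI impI, elim conjE)
  fix C assume C: "C \<lhd> G" "C \<subseteq> D" and tor: "\<forall>z\<in>C \<inter> M. p_element G p z"
    and cen: "\<forall>z\<in>C \<inter> M. \<forall>y\<in>C. p_regular G p y \<longrightarrow> y \<otimes> z = z \<otimes> y"
  interpret C: normal C G by fact
  interpret M: normal M G by fact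
  interpret N: normal N G by fact
  let ?Q = "G Mod M"
  interpret Q: group ?Q by (rule M.factorgroup_is_group)
  interpret h: group_hom G ?Q "\<lambda>x. M #> x" by (rule M.r_coset_group_hom)
  have aG: "a \<in> carrier G" using a by simp
  define c where "c = M #> a"
  have c: "c \<in> carrier ?Q" "c [^]\<^bsub>?Q\<^esub> q = \<one>\<^bsub>?Q\<^esub>"
    using aG a by (auto simp: c_def M.FactGroup_pow M.rcos_eq_one_iff)
  have ex: "\<exists>k::nat. M #> z = c [^]\<^bsub>?Q\<^esub> k" if "z \<in> N" for z
    using NM that M.in_cyclic_over_iff[OF aG] c_def by blast
  have qp: "coprime q p" using q p primes_coprime by blast
  have powC: "z [^] (n::nat) \<in> C" if "z \<in> C" for z n using that by (induction n) auto
  have powN: "z [^] (n::nat) \<in> N" if "z \<in> N" for z n using that by (induction n) auto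
  have powq: "z [^] q \<in> M" if z: "z \<in> N" for z
  proof -
    obtain l :: nat where l: "M #> z = c [^]\<^bsub>?Q\<^esub> l" using ex z by blast
    have "M #> z [^] q = (c [^]\<^bsub>?Q\<^esub> l) [^]\<^bsub>?Q\<^esub> q" using l z by (simp flip: M.FactGroup_pow)
    also have "\<dots> = (c [^]\<^bsub>?Q\<^esub> q) [^]\<^bsub>?Q\<^esub> l" using c(1) by (simp only: Q.nat_pow_pow mult.commute)
    also have "\<dots> = M" using c(2) by (metis Q.nat_pow_one one_FactGroup)
    finally show ?thesis using z M.rcos_eq_one_iff by simp
  qed
  have sub: "C \<inter> N \<subseteq> M"
  proof
    fix z assume z: "z \<in> C \<inter> N"
    have zG: "z \<in> carrier G" using z by auto
    show "z \<in> M"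
    proof (rule ccontr)
      assume zM: "z \<notin> M"
      have "Coset.order G \<noteq> 0" using fin order_gt_0_iff_finite by simp
      then obtain m where m: "Coset.order G = p ^ multiplicity p (Coset.order G) * m" "\<not> p dvd m"
        using multiplicity_decompose' p by (metis not_prime_unit)
      define e where "e = multiplicity p (Coset.order G)"
      have mp: "coprime m p" using m(2) p by (metis coprime_commute prime_imp_coprime)
      \<comment> \<open>the power of \<open>z\<close> that removes the \<open>p\<close>-part of its order\<close>
      define x where "x = z [^] (p ^ e)"
      have xG: "x \<in> carrier G" using zG x_def by simp
      have xC: "x \<in> C" and xN: "x \<in> N" using z powC powN by (auto simp: x_def)
      have xm: "x [^] m = \<one>" using pow_order_eq_1[OF zG] m(1) zG by (simp add: x_def e_def nat_pow_pow)
      have xM: "x \<notin> M"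
      proof
        assume "x \<in> M"
        then have "(M #> z) [^]\<^bsub>?Q\<^esub> (p ^ e) = \<one>\<^bsub>?Q\<^esub>"
          using zG xG M.rcos_eq_one_iff by (simp add: M.FactGroup_pow flip: x_def)
        moreover have "(M #> z) [^]\<^bsub>?Q\<^esub> q = \<one>\<^bsub>?Q\<^esub>"
          using powq z zG M.rcos_eq_one_iff by (simp add: M.FactGroup_pow)
        moreover have "coprime (p ^ e) q" using qp by (simp add: coprime_commute)
        ultimately have "M #> z = \<one>\<^bsub>?Q\<^esub>"
          using Q.one_if_coprime_powers h.hom_closed[OF zG] by blast
        then show False using zM zG M.rcos_eq_one_iff by simp
      qed
      have xt: "p_regular G p x" using xm mp by (auto simp: p_regular_def)
      have "x [^] q \<in> C \<inter> M" using powq xN powC xC by blast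
      then have "p_element G p (x [^] q)" using tor by blast
      moreover have "(x [^] q) [^] m = \<one>"
      proof -
        have "(x [^] q) [^] m = (x [^] m) [^] q" using xG by (simp add: nat_pow_pow mult.commute)
        then show ?thesis using xm by simp
      qed
      ultimately have xq: "x [^] q = \<one>" using p_element_eq_one[of "x [^] q" p m] xG mp by blast
      have x1: "x \<noteq> \<one>" using xM by auto
      obtain l :: nat where l: "M #> x = c [^]\<^bsub>?Q\<^esub> l" using ex xN by blast
      have "c [^]\<^bsub>?Q\<^esub> l \<noteq> \<one>\<^bsub>?Q\<^esub>" unfolding l[symmetric] using xM xG M.rcos_eq_one_iff by simp
      then obtain j :: nat where j: "c = (M #> x) [^]\<^bsub>?Q\<^esub> j"
        using Q.exists_power_generating[OF c q(1)] l by metis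
      have "\<exists>k::nat. g \<otimes> x \<otimes> inv g = x [^] k" if g: "g \<in> carrier G" for g
      proof -
        let ?y = "g \<otimes> x \<otimes> inv g"
        have yG: "?y \<in> carrier G" using g xG by simp
        have yN: "?y \<in> N" and yC: "?y \<in> C" using g xN xC N.inv_op_closed2 C.inv_op_closed2 by auto
        obtain i :: nat where "M #> ?y = c [^]\<^bsub>?Q\<^esub> i" using ex yN by blast
        also have "\<dots> = M #> x [^] (j * i)"
          unfolding j using xG by (simp add: M.FactGroup_pow nat_pow_pow)
        finally have eq: "M #> ?y = M #> x [^] (j * i)" .
        define k where "k = j * i"
        define u where "u = ?y \<otimes> inv (x [^] k)"
        have uG: "u \<in> carrier G" using yG xG by (simp add: u_def)
        have uM: "u \<in> M" using eq yG xG M.rcos_eq_iff by (simp add: u_def k_def)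
        have uC: "u \<in> C" using yC powC[OF xC] by (simp add: u_def)
        have "x [^] k \<otimes> u = u \<otimes> x [^] k"
        proof -
          have "(x [^] k) [^] m = (x [^] m) [^] k" using xG by (simp add: nat_pow_pow mult.commute)
          then have "p_regular G p (x [^] k)" using xm mp by (auto simp: p_regular_def)
          then show ?thesis using cen uM uC powC[OF xC] by blast
        qed
        moreover have yu: "?y = u \<otimes> x [^] k" using yG xG by (simp add: u_def m_assoc)
        ultimately have "?y [^] q = u [^] q \<otimes> (x [^] k) [^] q"
          using pow_mult_distrib[of u "x [^] k" q] uG xG by simp
        moreover have "(x [^] k) [^] q = \<one>"
        proof -
          have "(x [^] k) [^] q = (x [^] q) [^] k" using xG by (simp add: nat_pow_pow mult.commute)
          then show ?thesis using xq by simp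
        qed
        moreover have "?y [^] q = \<one>" using conj_nat_pow[OF g xG, of q] xq g by simp
        ultimately have "u [^] q = \<one>" using uG by simp
        then have "u = \<one>" using p_element_eq_one[OF uG _ _ qp] tor uM uC by blast
        then show ?thesis using yu xG by auto
      qed
      then have "prime_order_normal G q x"
        unfolding prime_order_normal_def using q xG x1 xq by blast
      then show False using min q by blast
    qed
  qed
  show "\<forall>z\<in>C. p_element G p z"
    using det[unfolded detects_p_groups_def, rule_format, of C] C tor cen sub by blast
qed

text \<open>The intersection of the centralizers of those factors of the series above \<open>M\<close> that have order
  \<open>p\<close> serves as \<open>D\<close>.\<close>

lemma (in group) exists_detecting_subgroup:
  assumes "prime_series G M" and fin: "finite (carrier G)" and p: "prime p"
    and min: "\<forall>b r. prime_order_normal G r b \<longrightarrow> r = p"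
  shows "\<exists>D. D \<lhd> G \<and>
    (\<forall>x\<in>carrier G. \<forall>y\<in>carrier G. x \<otimes> y \<otimes> inv x \<otimes> inv y \<in> D) \<and>
    (\<forall>x\<in>carrier G. x [^] (p - 1) \<in> D) \<and> detects_p_groups G p M D"
  using assms(1)
proof (induction rule: prime_series.induct)
  case top
  have "detects_p_groups G p (carrier G) (carrier G)"
    unfolding detects_p_groups_def by (auto simp: Int_absorb2)
  then show ?case using prime_series_normal[OF prime_series.top] by (intro exI[of _ "carrier G"]) simp
next
  case (step N M)
  then obtain D where D: "D \<lhd> G" "\<forall>x\<in>carrier G. \<forall>y\<in>carrier G. x \<otimes> y \<otimes> inv x \<otimes> inv y \<in> D"
    "\<forall>x\<in>carrier G. x [^] (p - 1) \<in> D" "detects_p_groups G p N D" by blast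
  have N: "N \<lhd> G" using prime_series_normal[OF step(1)] .
  obtain q a where q: "prime (q::nat)" and a: "a \<in> N" "a [^] q \<in> M" "N \<subseteq> cyclic_over G M a"
    using step(3) unfolding prime_step_def by blast
  show ?case
  proof (cases "q = p")
    case True
    then show ?thesis
      using detects_p_groups_step_p[OF D(4) step(2) D(1) p a(1) _ a(3) N] a(2) D(2,3) by blast
  next
    case False
    have "detects_p_groups G p M D"
      by (rule detects_p_groups_step_other[OF fin D(4) step(2) p q False a N]) (use min in blast)
    then show ?thesis using D by blast
  qed
qed

lemma (in group) exists_prime_order_normal:
  assumes "prime_series G M" "M = {\<one>}" "carrier G \<noteq> {\<one>}"
  shows "\<exists>q a. prime_order_normal G q a"
  using assms
proof (induction rule: prime_series.induct)
  case (step N M)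
  show ?case
  proof (cases "N = {\<one>}")
    case True
    then show ?thesis using step by blast
  next
    case False
    interpret N: normal N G using prime_series_normal[OF step(1)] .
    obtain q a where q: "prime (q::nat)" and a: "a \<in> N" "a [^] q \<in> M" "N \<subseteq> cyclic_over G M a"
      using step(3) unfolding prime_step_def by blast
    have aG: "a \<in> carrier G" using a by simp
    have pow: "\<exists>k::nat. z = a [^] k" if "z \<in> N" for z
      using a(3) that step(5) aG by (auto simp: cyclic_over_def r_coset_def)
    have "a \<noteq> \<one>" using pow False N.one_closed by (metis nat_pow_one singletonI subsetI subset_singletonD empty_iff insertE)
    moreover have "a [^] q = \<one>" using a(2) step(5) by simp
    moreover have "\<exists>k::nat. g \<otimes> a \<otimes> inv g = a [^] k" if "g \<in> carrier G" for g
      using pow N.inv_op_closed2 that a(1) by blast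
    ultimately show ?thesis unfolding prime_order_normal_def using q aG by blast
  qed
qed simp

lemma (in group) prime_order_normal_subgroup:
  assumes "prime_order_normal G q a"
  shows "\<exists>N. N \<lhd> G \<and> N \<noteq> {\<one>} \<and> (\<forall>z\<in>N. \<exists>k::nat. z = a [^] k)"
proof -
  interpret T: normal "{\<one>}" G by (rule one_is_normal)
  have a: "a \<in> carrier G" "a [^] q = \<one>" "a \<noteq> \<one>" "q > 0"
    "\<And>g. g \<in> carrier G \<Longrightarrow> \<exists>k::nat. g \<otimes> a \<otimes> inv g = a [^] k"
    using assms prime_gt_0_nat unfolding prime_order_normal_def by auto
  have mem: "z \<in> cyclic_over G {\<one>} a \<longleftrightarrow> (\<exists>k::nat. z = a [^] k)" for z
    using a(1) by (auto simp: cyclic_over_def r_coset_def)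
  have "cyclic_over G {\<one>} a \<lhd> G"
    by (rule T.cyclic_over_normal[OF a(1) _ a(4)]) (use a(2,5) mem in auto)
  moreover have "a \<in> cyclic_over G {\<one>} a" unfolding mem using a(1) by (intro exI[of _ "1::nat"]) simp
  ultimately show ?thesis using mem a(3) by blast
qed

text \<open>Let \<open>G\<close> be finite and supersolvable, and let \<open>x\<close> lie outside a subgroup \<open>S\<close> but inside \<open>N S\<close> for
  every nontrivial normal subgroup \<open>N\<close>. Then all normal subgroups of prime order have the same order
  \<open>p\<close>. Otherwise \<open>x = n s = m t\<close> with \<open>s, t \<in> S\<close>, where \<open>n\<close> and \<open>m\<close> commute and have different prime
  orders; then \<open>n\<close> is a power of \<open>m\<^sup>-\<^sup>1 n = t s\<^sup>-\<^sup>1 \<in> S\<close>, so that \<open>x \<in> S\<close>.\<close>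

lemma exists_variety_H:
  fixes G :: "'a monoid" (structure)
  assumes "group G" and fin: "finite (carrier G)" and series: "prime_series G {\<one>}"
    and S: "subgroup S G" and x: "x \<in> carrier G" "x \<notin> S"
    and mono: "\<And>N. \<lbrakk>N \<lhd> G; N \<noteq> {\<one>}\<rbrakk> \<Longrightarrow> \<exists>n\<in>N. \<exists>s\<in>S. x = n \<otimes> s"
  shows "\<exists>p. prime p \<and> variety_H p G"
proof -
  interpret group G by fact
  interpret S: subgroup S G by fact
  have powS: "s [^] (n::nat) \<in> S" if "s \<in> S" for s n using that by (induction n) auto
  have "carrier G \<noteq> {\<one>}" using x S.one_closed by auto
  then obtain p a where a: "prime_order_normal G p a" using exists_prime_order_normal[OF series refl] by blast
  have "p = r" if b: "prime_order_normal G r b" for r b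
  proof (rule ccontr)
    assume "p \<noteq> r"
    have aD: "a \<in> carrier G" "a [^] p = \<one>" "prime p"
      "\<And>g. g \<in> carrier G \<Longrightarrow> \<exists>k::nat. g \<otimes> a \<otimes> inv g = a [^] k"
      using a unfolding prime_order_normal_def by auto
    have bD: "b \<in> carrier G" "b [^] r = \<one>" "prime r"
      "\<And>g. g \<in> carrier G \<Longrightarrow> \<exists>k::nat. g \<otimes> b \<otimes> inv g = b [^] k"
      using b unfolding prime_order_normal_def by auto
    have pr: "coprime p r" using \<open>p \<noteq> r\<close> aD bD primes_coprime by blast
    obtain N where N: "N \<lhd> G" "N \<noteq> {\<one>}" "\<And>z. z \<in> N \<Longrightarrow> \<exists>k::nat. z = a [^] k"
      using prime_order_normal_subgroup[OF a] by blast
    obtain M where M: "M \<lhd> G" "M \<noteq> {\<one>}" "\<And>z. z \<in> M \<Longrightarrow> \<exists>k::nat. z = b [^] k"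
      using prime_order_normal_subgroup[OF b] by blast
    interpret N: normal N G by fact
    interpret M: normal M G by fact
    obtain n s where n: "n \<in> N" "s \<in> S" "x = n \<otimes> s" using mono[OF N(1,2)] by blast
    obtain m t where m: "m \<in> M" "t \<in> S" "x = m \<otimes> t" using mono[OF M(1,2)] by blast
    have G: "n \<in> carrier G" "m \<in> carrier G" "s \<in> carrier G" "t \<in> carrier G"
      using n m by auto
    have Np: "z [^] p = \<one>" if z: "z \<in> N" for z
    proof -
      obtain k :: nat where "z = a [^] k" using N(3)[OF z] by blast
      then have "z [^] p = (a [^] p) [^] k" using aD(1) by (simp add: nat_pow_pow mult.commute)
      then show ?thesis using aD by simp
    qed
    have Mr: "z [^] r = \<one>" if z: "z \<in> M" for z
    proof -
      obtain k :: nat where "z = b [^] k" using M(3)[OF z] by blast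
      then have "z [^] r = (b [^] r) [^] k" using bD(1) by (simp add: nat_pow_pow mult.commute)
      then show ?thesis using bD by simp
    qed
    let ?u = "inv m"
    have u: "?u \<in> M" "?u \<in> carrier G" using m G by auto
    let ?w = "?u \<otimes> n \<otimes> inv ?u \<otimes> inv n"
    have "?w \<in> N" using N.inv_op_closed2[OF u(2) n(1)] n(1) by blast
    moreover have "?w = ?u \<otimes> (n \<otimes> inv ?u \<otimes> inv n)" using u G by (simp add: m_assoc)
    then have "?w \<in> M" using M.inv_op_closed2[OF G(1), of "inv ?u"] u(1) by simp
    ultimately have "?w = \<one>" using one_if_coprime_powers[OF _ Np Mr pr] N.mem_carrier by blast
    then have un: "?u \<otimes> n = n \<otimes> ?u"
      using u G by (metis inv_equality inv_inv inv_solve_right l_one m_closed inv_closed)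
    have eq: "?u \<otimes> n = t \<otimes> inv s"
    proof -
      have "?u \<otimes> (n \<otimes> s) = ?u \<otimes> (m \<otimes> t)" using n m by simp
      also have "\<dots> = t" using G by (simp flip: m_assoc)
      finally have "?u \<otimes> n \<otimes> s = t" using G by (simp add: m_assoc)
      then show ?thesis using G by (metis inv_solve_right m_closed inv_closed)
    qed
    then have "?u \<otimes> n \<in> S" using n m by simp
    then have "(?u \<otimes> n) [^] r \<in> S" by (rule powS)
    moreover have "(?u \<otimes> n) [^] r = n [^] r"
      using pow_mult_distrib[OF un u(2) G(1), of r] Mr[OF u(1)] G by simp
    ultimately have nr: "n [^] r \<in> S" by simp
    obtain j where "[r * j = 1] (mod p)" using cong_solve_coprime_nat[of r p] pr by (auto simp: coprime_commute)
    then have "n [^] (r * j) = n [^] (1::nat)" using Np[OF n(1)] G by (intro pow_mod_of_pow_one[of n p])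
    then have "n = (n [^] r) [^] j" using G by (simp add: nat_pow_pow)
    then have "n \<in> S" using powS[OF nr, of j] by simp
    then show False using x n by simp
  qed
  then have min: "\<forall>b r. prime_order_normal G r b \<longrightarrow> r = p" by blast
  have p: "prime p" using a by (simp add: prime_order_normal_def)
  obtain D where D: "D \<lhd> G" "\<forall>x\<in>carrier G. \<forall>y\<in>carrier G. x \<otimes> y \<otimes> inv x \<otimes> inv y \<in> D"
    "\<forall>x\<in>carrier G. x [^] (p - 1) \<in> D" "detects_p_groups G p {\<one>} D"
    using exists_detecting_subgroup[OF series fin p min] by metis
  interpret D: normal D G by fact
  interpret GD: group "G\<lparr>carrier := D\<rparr>" using D.subgroup_axioms subgroup_imp_group by blast
  have "p_element G p \<one>" by (simp add: p_element_def)
  then have "\<forall>z\<in>D. p_element G p z"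
    by (intro ballI, intro D(4)[unfolded detects_p_groups_def, rule_format, of D] conjI)
      (use D(1) in simp_all)
  then have "\<exists>k. Coset.order (G\<lparr>carrier := D\<rparr>) = p ^ k"
    using fin D.subset finite_subset nat_pow_consistent[where H = D]
    by (intro GD.order_eq_prime_power[OF _ p]) (auto simp: p_element_def)
  then have "\<exists>k. card D = p ^ k" by (simp add: Coset.order_def)
  then show ?thesis using variety_H_iff[OF is_group fin, of p] D(1-3) p by blast
qed

section \<open>The pro-supersolvable topology\<close>

lemma variety_H_imp_variety_Su:
  assumes p: "prime p" and H: "variety_H p G"
  shows "variety_Su G"
proof -
  have G: "group G" "finite (carrier G)" using H by (auto simp: variety_H_def variety_product_def)
  interpret group G by fact
  obtain N k where N: "N \<lhd> G" "card N = p ^ k"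
    "\<forall>x\<in>carrier G. \<forall>y\<in>carrier G. x \<otimes>\<^bsub>G\<^esub> y \<otimes>\<^bsub>G\<^esub> inv\<^bsub>G\<^esub> x \<otimes>\<^bsub>G\<^esub> inv\<^bsub>G\<^esub> y \<in> N"
    "\<forall>x\<in>carrier G. x [^]\<^bsub>G\<^esub> (p - 1) \<in> N"
    using H unfolding variety_H_iff[OF G] by (elim exE conjE)
  have "prime_series G {\<one>\<^bsub>G\<^esub>}"
    by (rule prime_series_of_p_by_abelian[OF G(2) N(1) p N(2) _ _ one_is_normal])
      (use N(3,4) in simp_all)
  then show ?thesis using supersolvable_iff_prime_series[OF G] G by (simp add: variety_Su_def)
qed

lemma variety_H_trivial_FactGroup:
  assumes "group F"
  shows "carrier F \<lhd> F" "variety_H p (F Mod carrier F)"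
proof -
  interpret group F by fact
  show n: "carrier F \<lhd> F" by (simp add: normal_inv_iff subgroup_self)
  then interpret n: normal "carrier F" F .
  let ?Q = "F Mod carrier F"
  interpret Q: group ?Q by (rule n.factorgroup_is_group)
  have c: "carrier ?Q = {\<one>\<^bsub>?Q\<^esub>}"
  proof -
    have "carrier F #>\<^bsub>F\<^esub> x = carrier F" if "x \<in> carrier F" for x using that n.rcos_const[OF assms] by blast
    then show ?thesis by (auto simp: carrier_FactGroup intro!: image_eqI[of _ _ "\<one>\<^bsub>F\<^esub>"])
  qed
  have "\<exists>k. card {\<one>\<^bsub>?Q\<^esub>} = p ^ k" by (intro exI[of _ 0]) simp
  moreover have "\<forall>x\<in>carrier ?Q. \<forall>y\<in>carrier ?Q. x \<otimes>\<^bsub>?Q\<^esub> y \<otimes>\<^bsub>?Q\<^esub> inv\<^bsub>?Q\<^esub> x \<otimes>\<^bsub>?Q\<^esub> inv\<^bsub>?Q\<^esub> y \<in> {\<one>\<^bsub>?Q\<^esub>}"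
    unfolding c[symmetric] by (intro ballI Q.m_closed Q.inv_closed)
  moreover have "\<forall>x\<in>carrier ?Q. x [^]\<^bsub>?Q\<^esub> (p - 1) \<in> {\<one>\<^bsub>?Q\<^esub>}"
    unfolding c[symmetric] by (intro ballI Q.nat_pow_closed)
  moreover have "finite (carrier ?Q)" unfolding c by simp
  ultimately show "variety_H p ?Q"
    using Q.one_is_normal unfolding variety_H_iff[OF Q.is_group \<open>finite (carrier ?Q)\<close>]
    by (intro exI[of _ "{\<one>\<^bsub>?Q\<^esub>}"] conjI)
qed

lemma variety_Su_FactGroup_inter:
  assumes "group F" "K \<lhd> F" "L \<lhd> F" "variety_Su (F Mod K)" "variety_Su (F Mod L)"
  shows "variety_Su (F Mod (K \<inter> L))"
proof -
  interpret group F by fact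
  interpret K: normal K F by fact
  interpret L: normal L F by fact
  have n: "K \<inter> L \<lhd> F" using assms normal_subgroup_intersect by blast
  have fin: "finite (carrier (F Mod K))" "finite (carrier (F Mod L))"
    and ser: "prime_series F K" "prime_series F L"
    using assms variety_Su_FactGroup_iff[OF assms(1)] by blast+
  have "(K \<inter> L) #>\<^bsub>F\<^esub> x = (K #>\<^bsub>F\<^esub> x) \<inter> (L #>\<^bsub>F\<^esub> x)" if "x \<in> carrier F" for x
  proof
    show "(K #>\<^bsub>F\<^esub> x) \<inter> (L #>\<^bsub>F\<^esub> x) \<subseteq> (K \<inter> L) #>\<^bsub>F\<^esub> x"
      using that K.subset L.subset right_cancel by (fastforce simp: r_coset_def)
  qed (auto simp: r_coset_def)
  then have "carrier (F Mod (K \<inter> L)) \<subseteq> (\<lambda>(A, B). A \<inter> B) ` (carrier (F Mod K) \<times> carrier (F Mod L))"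
    by (auto simp: carrier_FactGroup)
  then have "finite (carrier (F Mod (K \<inter> L)))" using fin finite_subset by blast
  then show ?thesis
    using variety_Su_FactGroup_iff[OF assms(1) n] prime_series_inter[OF ser] by blast
qed

text \<open>The cosets in the pro-supersolvable basis are a basis and not only a subbasis.\<close>

lemma openin_pro_topology_Su_nbhd:
  assumes "group F" "openin (pro_topology variety_Su F) U" "x \<in> U"
  shows "\<exists>K. K \<lhd> F \<and> variety_Su (F Mod K) \<and> K #>\<^bsub>F\<^esub> x \<subseteq> U"
proof -
  interpret group F by fact
  have "generate_topology_on (pro_basis variety_Su F) U"
    using assms(2) by (simp add: pro_topology_def openin_topology_generated_by_iff)
  then show ?thesis using assms(3)
  proof (induction arbitrary: x rule: generate_topology_on.induct)
    case (Int A B)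
    then obtain K L where K: "K \<lhd> F" "variety_Su (F Mod K)" "K #>\<^bsub>F\<^esub> x \<subseteq> A"
      and L: "L \<lhd> F" "variety_Su (F Mod L)" "L #>\<^bsub>F\<^esub> x \<subseteq> B" by (meson IntD1 IntD2)
    have "(K \<inter> L) #>\<^bsub>F\<^esub> x \<subseteq> A \<inter> B" using K(3) L(3) by (auto simp: r_coset_def)
    moreover have "K \<inter> L \<lhd> F" by (rule normal_subgroup_intersect[OF K(1) L(1)])
    moreover have "variety_Su (F Mod (K \<inter> L))"
      by (rule variety_Su_FactGroup_inter[OF assms(1) K(1) L(1) K(2) L(2)])
    ultimately show ?case by blast
  next
    case (UN \<U>)
    then obtain U where "U \<in> \<U>" "x \<in> U" by blast
    then show ?case using UN.IH[of U x] Union_upper[of U \<U>] by (metis subset_trans)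
  next
    case (Basis B)
    then obtain K y where K: "B = K #>\<^bsub>F\<^esub> y" "K \<lhd> F" "variety_Su (F Mod K)" "y \<in> carrier F"
      by (auto simp: pro_basis_def)
    then have "K #>\<^bsub>F\<^esub> x = B" using Basis normal_imp_subgroup repr_independence by blast
    then show ?case using K by blast
  qed simp
qed

lemma topspace_pro_topology_subset:
  assumes "group F" shows "topspace (pro_topology V F) \<subseteq> carrier F"
proof -
  interpret group F by fact
  have "K #>\<^bsub>F\<^esub> x \<subseteq> carrier F" if "K \<lhd> F" "x \<in> carrier F" for K x
    using that r_coset_subset_G normal_imp_subgroup subgroup.subset by metis
  then show ?thesis unfolding pro_topology_def pro_basis_def topology_generated_by_topspace by blast
qed

text \<open>The preimage \<open>M\<close> in \<open>F\<close> of a normal subgroup of \<open>F / K\<close> defines a supersolvable quotient of \<open>F\<close>,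
  which is smaller than \<open>F / K\<close> unless \<open>M = K\<close>.\<close>

lemma variety_Su_FactGroup_preimage:
  assumes "group F" "K \<lhd> F" "variety_Su (F Mod K)" "N \<lhd> F Mod K"
  defines "M \<equiv> {x \<in> carrier F. K #>\<^bsub>F\<^esub> x \<in> N}"
  shows "M \<lhd> F" "variety_Su (F Mod M)"
    "N \<noteq> {\<one>\<^bsub>F Mod K\<^esub>} \<Longrightarrow> card (carrier (F Mod M)) < card (carrier (F Mod K))"
proof -
  interpret group F by fact
  interpret K: normal K F by fact
  interpret Q: group "F Mod K" by (rule K.factorgroup_is_group)
  interpret h: group_hom F "F Mod K" "\<lambda>x. K #>\<^bsub>F\<^esub> x" by (rule K.r_coset_group_hom)
  interpret N: normal N "F Mod K" by fact
  show M: "M \<lhd> F" unfolding M_def by (rule h.normal_preimage) fact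
  then interpret M: normal M F .
  interpret MQ: group "F Mod M" by (rule M.factorgroup_is_group)
  interpret m: group_hom F "F Mod M" "\<lambda>x. M #>\<^bsub>F\<^esub> x" by (rule M.r_coset_group_hom)
  have KM: "K \<subseteq> M"
  proof
    fix x assume x: "x \<in> K"
    have "K #>\<^bsub>F\<^esub> x = \<one>\<^bsub>F Mod K\<^esub>" unfolding one_FactGroup by (rule K.rcos_const[OF is_group x])
    then have "K #>\<^bsub>F\<^esub> x \<in> N" using N.one_closed by argo
    then show "x \<in> M" unfolding M_def using K.mem_carrier[OF x] by blast
  qed
  have fin: "finite (carrier (F Mod K))" and ser: "prime_series F K"
    using assms variety_Su_FactGroup_iff by blast+
  let ?f = "\<lambda>C. M <#>\<^bsub>F\<^esub> C"
  have f: "?f (K #>\<^bsub>F\<^esub> x) = M #>\<^bsub>F\<^esub> x" if x: "x \<in> carrier F" for x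
  proof
    show "M <#>\<^bsub>F\<^esub> (K #>\<^bsub>F\<^esub> x) \<subseteq> M #>\<^bsub>F\<^esub> x"
    proof
      fix z assume "z \<in> M <#>\<^bsub>F\<^esub> (K #>\<^bsub>F\<^esub> x)"
      then obtain a k where "a \<in> M" "k \<in> K" "z = a \<otimes>\<^bsub>F\<^esub> (k \<otimes>\<^bsub>F\<^esub> x)"
        by (auto simp: set_mult_def r_coset_def)
      moreover from this have "z = (a \<otimes>\<^bsub>F\<^esub> k) \<otimes>\<^bsub>F\<^esub> x" using x by (simp add: m_assoc)
      moreover have "a \<otimes>\<^bsub>F\<^esub> k \<in> M" using calculation KM by blast
      ultimately show "z \<in> M #>\<^bsub>F\<^esub> x" unfolding r_coset_def by blast
    qed
    show "M #>\<^bsub>F\<^esub> x \<subseteq> M <#>\<^bsub>F\<^esub> (K #>\<^bsub>F\<^esub> x)"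
      using rcos_self[OF x K.subgroup_axioms]
      unfolding set_mult_def r_coset_def[of F M] by blast
  qed
  have im: "carrier (F Mod M) = ?f ` carrier (F Mod K)"
    using f by (auto simp: carrier_FactGroup image_iff)
  have "(\<lambda>x. M #>\<^bsub>F\<^esub> x) ` K = {\<one>\<^bsub>F Mod M\<^esub>}"
  proof -
    have "M #>\<^bsub>F\<^esub> x = M" if "x \<in> K" for x using that KM M.rcos_const[OF is_group] by blast
    moreover have "\<one>\<^bsub>F\<^esub> \<in> K" by (rule K.one_closed)
    ultimately show ?thesis unfolding one_FactGroup by blast
  qed
  then have "prime_series (F Mod M) {\<one>\<^bsub>F Mod M\<^esub>}"
    using m.prime_series_image[OF _ ser] by (simp add: carrier_FactGroup)
  moreover have finM: "finite (carrier (F Mod M))" unfolding im using fin by simp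
  ultimately show "variety_Su (F Mod M)"
    unfolding variety_Su_def using supersolvable_iff_prime_series[OF MQ.is_group] by blast
  assume ne: "N \<noteq> {\<one>\<^bsub>F Mod K\<^esub>}"
  have "\<not> inj_on ?f (carrier (F Mod K))"
  proof
    assume inj: "inj_on ?f (carrier (F Mod K))"
    obtain C where C: "C \<in> N" "C \<noteq> \<one>\<^bsub>F Mod K\<^esub>" using ne N.one_closed by blast
    then have "C \<in> carrier (F Mod K)" using N.mem_carrier by blast
    then obtain x where x: "x \<in> carrier F" "C = K #>\<^bsub>F\<^esub> x" by (auto simp: carrier_FactGroup)
    then have "x \<in> M" unfolding M_def using C by blast
    then have "?f C = M" unfolding x(2) f[OF x(1)] by (rule M.rcos_const[OF is_group])
    moreover have "?f \<one>\<^bsub>F Mod K\<^esub> = M"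
      using f[OF one_closed] K.rcos_const[OF is_group K.one_closed] M.rcos_const[OF is_group M.one_closed]
      unfolding one_FactGroup by argo
    ultimately have "?f C = ?f \<one>\<^bsub>F Mod K\<^esub>" by argo
    then show False using inj C \<open>C \<in> carrier (F Mod K)\<close> by (metis Q.one_closed inj_onD)
  qed
  then show "card (carrier (F Mod M)) < card (carrier (F Mod K))"
    unfolding im
    by (intro le_neq_implies_less card_image_le[OF fin] notI) (erule notE, erule eq_card_imp_inj_on[OF fin])
qed

theorem theorem3p29:
  fixes F :: "'a monoid" and H :: "'a set"
  assumes "free_group F"
    and "finitely_generated_group F"
    and "subgroup H F"
  shows "Cl variety_Su F H = (\<Inter>p\<in>{p::nat. prime p}. Cl (variety_H p) F H)"
proof
  have F: "group F" using assms by (simp add: free_group_def)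
  interpret group F by fact
  interpret H: subgroup H F by fact
  show "Cl variety_Su F H \<subseteq> (\<Inter>p\<in>{p::nat. prime p}. Cl (variety_H p) F H)"
  proof (intro INT_greatest subsetI)
    fix p :: nat and x assume p: "p \<in> {p. prime p}" and x: "x \<in> Cl variety_Su F H"
    have xF: "x \<in> carrier F"
      using x topspace_pro_topology_subset[OF F] by (auto simp: Cl_def in_closure_of)
    have "pro_basis (variety_H p) F \<subseteq> pro_basis variety_Su F"
      using variety_H_imp_variety_Su p by (auto simp: pro_basis_def)
    then have coarser: "openin (pro_topology variety_Su F) U"
      if "openin (pro_topology (variety_H p) F) U" for U
      using that generate_topology_on_coarsest[OF istopology_generate_topology_on]
      by (metis (no_types, lifting) generate_topology_on.Basis openin_topology_generated_by_iff pro_topology_def subsetD)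
    have "carrier F #>\<^bsub>F\<^esub> x \<in> pro_basis (variety_H p) F"
      unfolding pro_basis_def using variety_H_trivial_FactGroup[OF F] xF by blast
    moreover have "x \<in> carrier F #>\<^bsub>F\<^esub> x" using rcos_self[OF xF subgroup_self] .
    ultimately have "x \<in> topspace (pro_topology (variety_H p) F)" by (auto simp: pro_topology_def)
    then show "x \<in> Cl (variety_H p) F H"
      using x coarser by (auto simp: Cl_def in_closure_of)
  qed
  show "(\<Inter>p\<in>{p::nat. prime p}. Cl (variety_H p) F H) \<subseteq> Cl variety_Su F H"
  proof (rule subsetI, rule ccontr)
    fix x assume x: "x \<in> (\<Inter>p\<in>{p::nat. prime p}. Cl (variety_H p) F H)" and nx: "x \<notin> Cl variety_Su F H"
    have xF: "x \<in> carrier F"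
      using x topspace_pro_topology_subset[OF F] two_is_prime_nat by (fastforce simp: Cl_def in_closure_of)
    have meets: "(K #>\<^bsub>F\<^esub> x) \<inter> H \<noteq> {}" if "prime p" "K \<lhd> F" "variety_H p (F Mod K)" for p K
    proof -
      have "openin (pro_topology (variety_H p) F) (K #>\<^bsub>F\<^esub> x)"
        unfolding pro_topology_def using that xF
        by (intro topology_generated_by_Basis) (auto simp: pro_basis_def)
      moreover have "x \<in> K #>\<^bsub>F\<^esub> x" using rcos_self[OF xF normal_imp_subgroup] that by blast
      moreover have "x \<in> Cl (variety_H p) F H" using x that by blast
      ultimately show ?thesis by (auto simp: Cl_def in_closure_of)
    qed
    \<comment> \<open>among the supersolvable quotients that separate \<open>x\<close> from \<open>H\<close>, choose a smallest one\<close>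
    let ?sep = "\<lambda>K. K \<lhd> F \<and> variety_Su (F Mod K) \<and> (K #>\<^bsub>F\<^esub> x) \<inter> H = {}"
    have "\<exists>K. ?sep K"
    proof -
      have "variety_Su (F Mod carrier F)" "carrier F \<lhd> F"
        using variety_H_imp_variety_Su[OF two_is_prime_nat variety_H_trivial_FactGroup(2)[OF F]]
          variety_H_trivial_FactGroup(1)[OF F] by blast+
      then have "carrier F #>\<^bsub>F\<^esub> x \<in> pro_basis variety_Su F" unfolding pro_basis_def using xF by blast
      then have "x \<in> topspace (pro_topology variety_Su F)"
        using rcos_self[OF xF subgroup_self] by (auto simp: pro_topology_def)
      then obtain U where U: "openin (pro_topology variety_Su F) U" "x \<in> U" "U \<inter> H = {}"
        using nx unfolding Cl_def in_closure_of by blast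
      obtain K where "K \<lhd> F" "variety_Su (F Mod K)" "K #>\<^bsub>F\<^esub> x \<subseteq> U"
        using openin_pro_topology_Su_nbhd[OF F U(1,2)] by metis
      then have "?sep K" using U(3) by blast
      then show ?thesis ..
    qed
    then obtain K where K: "K \<lhd> F" "variety_Su (F Mod K)" "(K #>\<^bsub>F\<^esub> x) \<inter> H = {}"
      and least: "\<And>L. ?sep L \<Longrightarrow> card (carrier (F Mod K)) \<le> card (carrier (F Mod L))"
      using ex_has_least_nat[of ?sep _ "\<lambda>K. card (carrier (F Mod K))"] by blast
    interpret K: normal K F by fact
    let ?Q = "F Mod K"
    interpret Q: group ?Q by (rule K.factorgroup_is_group)
    interpret h: group_hom F ?Q "\<lambda>x. K #>\<^bsub>F\<^esub> x" by (rule K.r_coset_group_hom)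
    let ?S = "(\<lambda>x. K #>\<^bsub>F\<^esub> x) ` H"
    have finQ: "finite (carrier ?Q)" and serQ: "prime_series ?Q {\<one>\<^bsub>?Q\<^esub>}"
      using K(2) supersolvable_iff_prime_series[OF Q.is_group] by (auto simp: variety_Su_def)
    have "\<exists>p. prime p \<and> variety_H p ?Q"
    proof (rule exists_variety_H[OF Q.is_group finQ serQ])
      show "subgroup ?S ?Q" using h.subgroup_img_is_subgroup[OF H.subgroup_axioms] .
      show "K #>\<^bsub>F\<^esub> x \<in> carrier ?Q" using xF by (rule h.hom_closed)
      show "K #>\<^bsub>F\<^esub> x \<notin> ?S"
      proof
        assume "K #>\<^bsub>F\<^esub> x \<in> ?S"
        then obtain s where "s \<in> H" "K #>\<^bsub>F\<^esub> x = K #>\<^bsub>F\<^esub> s" by blast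
        then show False using K(3) rcos_self[OF H.mem_carrier K.subgroup_axioms] by blast
      qed
      fix N assume N: "N \<lhd> ?Q" "N \<noteq> {\<one>\<^bsub>?Q\<^esub>}"
      let ?M = "{x \<in> carrier F. K #>\<^bsub>F\<^esub> x \<in> N}"
      note M = variety_Su_FactGroup_preimage[OF F K(1,2) N(1)]
      have "\<not> ?sep ?M"
      proof
        assume "?sep ?M"
        from least[OF this] M(3)[OF N(2)] show False by linarith
      qed
      then obtain s where s: "s \<in> H" "s \<in> ?M #>\<^bsub>F\<^esub> x" using M(1,2) by blast
      then obtain m where m: "m \<in> ?M" "s = m \<otimes>\<^bsub>F\<^esub> x" by (auto simp: r_coset_def)
      interpret N: normal N ?Q by fact
      have "K #>\<^bsub>F\<^esub> (inv\<^bsub>F\<^esub> m) \<in> N" using m by simp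
      moreover have "x = inv\<^bsub>F\<^esub> m \<otimes>\<^bsub>F\<^esub> s" using m xF by (simp flip: m_assoc)
      then have "K #>\<^bsub>F\<^esub> x = (K #>\<^bsub>F\<^esub> (inv\<^bsub>F\<^esub> m)) \<otimes>\<^bsub>?Q\<^esub> (K #>\<^bsub>F\<^esub> s)"
        using m s H.mem_carrier by (metis (no_types, lifting) h.hom_mult inv_closed mem_Collect_eq)
      ultimately show "\<exists>n\<in>N. \<exists>s\<in>?S. K #>\<^bsub>F\<^esub> x = n \<otimes>\<^bsub>?Q\<^esub> s" using s by blast
    qed
    then show False using meets[OF _ K(1)] K(3) by blast
  qed
qed

end
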